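(* Suppose that $z^*$ is a solution of (NLP) at which the KKT conditions, MFCQ, the second-order conditions and the strict complementarity condition SC hold. Let constants $C>0$, $\gamma\in(0,1)$ and $K_t>0$ be fixed. Then there exist constants $\epsilon>0$ and $K>0$ such that, for all $(z,\lambda,s)$ satisfying the centrality conditions (with constants $C,\gamma$ and $\mu=\lambda^Ts/m$) with $\delta(z,\lambda)\le\epsilon$ and $\mu\le\epsilon$, and all $t\in\mathbb{R}^m$ with $\|t\|\le K_t\mu^2$, the (exact) solution $(\Delta z,\Delta\lambda,\Delta s)$ of $$\begin{bmatrix} \mathcal{L}_{zz}(z,\lambda) & \nabla g(z) & 0\\ \nabla g(z)^T & 0 & I\\ 0 & S & \Lambda\end{bmatrix}\begin{bmatrix}\Delta z\\ \Delta\lambda\\ \Delta s\end{bmatrix}=-\begin{bmatrix}\mathcal{L}_z(z,\lambda)\\ g(z)+s\\ S\Lambda e+t\end{bmatrix}$$ satisfies $\|(\Delta z,\Delta\lambda,\Delta s)\|\le K\mu$, that is, $(\Delta z,\Delta\lambda,\Delta s)=O(\mu)$.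
   Context: (NLP) is $\min_z\phi(z)$ subject to $g(z)\le0$, where $\phi:\mathbb{R}^n\to\mathbb{R}$ and $g:\mathbb{R}^n\to\mathbb{R}^m$ are twice Lipschitz continuously differentiable (no convexity is assumed). $\nabla g(z)=[\nabla g_1(z),\dots,\nabla g_m(z)]$ ($n\times m$). $\mathcal{L}(z,\lambda)=\phi(z)+\lambda^Tg(z)$; $\mathcal{L}_z$ and $\mathcal{L}_{zz}$ are its gradient and Hessian in $z$. $S=\mathrm{diag}(s)$, $\Lambda=\mathrm{diag}(\lambda)$, $e=(1,\dots,1)^T$. Norms are Euclidean. KKT conditions: $\mathcal{L}_z(z,\lambda)=0$, $g(z)\le0$, $\lambda\ge0$, $\lambda^Tg(z)=0$. $\mathcal{S}_\lambda$ is the (nonempty) set of $\lambda^*$ such that $(z^*,\lambda^* )$ satisfies the KKT conditions, $\mathcal{S}=\{z^*\}\times\mathcal{S}_\lambda$, and $\delta(z,\lambda)$ is the Euclidean distance from $(z,\lambda)$ to $\mathcal{S}$. $\mathcal{B}=\{i: g_i(z^* )=0\}$, $\mathcal{N}=\{1,\dots,m\}\setminus\mathcal{B}$, $\mathcal{B}_+=\{i\in\mathcal{B}:\lambda_i^*>0\text{ for some }\lambda^*\in\mathcal{S}_\lambda\}$. MFCQ: there is $\bar y\in\mathbb{R}^n$ with $\nabla g_i(z^* )^T\bar y<0$ for all $i\in\mathcal{B}$. Second-order conditions: there is $\xi>0$ with $w^T\mathcal{L}_{zz}(z^*,\lambda^* )w\ge\xi\|w\|^2$ for all $\lambda^*\in\mathcal{S}_\lambda$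 and all $w$ with $\nabla g_i(z^* )^Tw=0$ for $i\in\mathcal{B}_+$ and $\nabla g_i(z^* )^Tw\le0$ for $i\in\mathcal{B}\setminus\mathcal{B}_+$. SC: there is $\lambda^*\in\mathcal{S}_\lambda$ with $\lambda_i^*>0$ for all $i\in\mathcal{B}$. Centrality conditions for $(z,\lambda,s)\in\mathbb{R}^n\times\mathbb{R}^m\times\mathbb{R}^m$, with $\mu=\lambda^Ts/m$: $\|\mathcal{L}_z(z,\lambda)\|\le C\mu$; $\|g(z)+s\|\le C\mu$; $(\lambda,s)>0$ and $\lambda_is_i\ge\gamma\mu$ for all $i=1,\dots,m$. *)

theory Defs
  imports "HOL-Analysis.Analysis"
begin

definition grad :: "(real ^ 'n \<Rightarrow> real) \<Rightarrow> real ^ 'n \<Rightarrow> real ^ 'n"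
  where "grad f z = (\<chi> j. frechet_derivative f (at z) (axis j 1))"

definition hessian :: "(real ^ 'n \<Rightarrow> real) \<Rightarrow> real ^ 'n \<Rightarrow> real ^ 'n ^ 'n"
  where "hessian f z = jacobian (grad f) (at z)"

text \<open>The paper's \<open>n \<times> m\<close> matrix \<open>\<nabla>g(z)\<close>: its \<open>i\<close>-th column is the gradient of \<open>g\<^sub>i\<close>, so it is the
  transpose of the Jacobian of \<open>g\<close>.\<close>

definition grads :: "(real ^ 'n \<Rightarrow> real ^ 'm) \<Rightarrow> real ^ 'n \<Rightarrow> real ^ 'm ^ 'n"
  where "grads g z = (\<chi> j i. grad (\<lambda>y. g y $ i) z $ j)"

text \<open>Lipschitz continuity of the second derivative is required locally, i.e. near every point; this
  is implied by (and weaker than) Lipschitz continuity on the whole space. Continuity of the function, of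
  its gradient and of its Hessian follow.\<close>

definition twice_lipschitz_diff :: "(real ^ 'n \<Rightarrow> real) \<Rightarrow> bool"
  where "twice_lipschitz_diff f \<longleftrightarrow>
    (\<forall>z. f differentiable (at z)) \<and>
    (\<forall>z. grad f differentiable (at z)) \<and>
    (\<forall>z. \<exists>r>0. \<exists>L. L-lipschitz_on (cball z r) (hessian f))"

definition nlp_solution ::
    "(real ^ 'n \<Rightarrow> real) \<Rightarrow> (real ^ 'n \<Rightarrow> real ^ 'm) \<Rightarrow> real ^ 'n \<Rightarrow> bool"
  where \<comment> \<open>local minimizer: the problem is not assumed convex\<close>
    "nlp_solution \<phi> g zs \<longleftrightarrow>
      (\<forall>i. g zs $ i \<le> 0) \<and>
      (\<exists>r>0. \<forall>z\<in>ball zs r. (\<forall>i. g z $ i \<le> 0) \<longrightarrow> \<phi> zs \<le> \<phi> z)"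

definition lagrangian ::
    "(real ^ 'n \<Rightarrow> real) \<Rightarrow> (real ^ 'n \<Rightarrow> real ^ 'm) \<Rightarrow> real ^ 'n \<Rightarrow> real ^ 'm \<Rightarrow> real"
  where "lagrangian \<phi> g z lam = \<phi> z + lam \<bullet> g z"

definition lagr_z ::
    "(real ^ 'n \<Rightarrow> real) \<Rightarrow> (real ^ 'n \<Rightarrow> real ^ 'm) \<Rightarrow> real ^ 'n \<Rightarrow> real ^ 'm \<Rightarrow> real ^ 'n"
  where "lagr_z \<phi> g z lam = grad (\<lambda>y. lagrangian \<phi> g y lam) z"

definition lagr_zz ::
    "(real ^ 'n \<Rightarrow> real) \<Rightarrow> (real ^ 'n \<Rightarrow> real ^ 'm) \<Rightarrow> real ^ 'n \<Rightarrow> real ^ 'm \<Rightarrow> real ^ 'n ^ 'n"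
  where "lagr_zz \<phi> g z lam = hessian (\<lambda>y. lagrangian \<phi> g y lam) z"

definition KKT ::
    "(real ^ 'n \<Rightarrow> real) \<Rightarrow> (real ^ 'n \<Rightarrow> real ^ 'm) \<Rightarrow> real ^ 'n \<Rightarrow> real ^ 'm \<Rightarrow> bool"
  where "KKT \<phi> g z lam \<longleftrightarrow>
    lagr_z \<phi> g z lam = 0 \<and> (\<forall>i. g z $ i \<le> 0) \<and> (\<forall>i. 0 \<le> lam $ i) \<and> lam \<bullet> g z = 0"

definition multipliers ::
    "(real ^ 'n \<Rightarrow> real) \<Rightarrow> (real ^ 'n \<Rightarrow> real ^ 'm) \<Rightarrow> real ^ 'n \<Rightarrow> (real ^ 'm) set"
  where "multipliers \<phi> g zs = {lam. KKT \<phi> g zs lam}"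

definition sol_dist ::
    "(real ^ 'n \<Rightarrow> real) \<Rightarrow> (real ^ 'n \<Rightarrow> real ^ 'm) \<Rightarrow> real ^ 'n \<Rightarrow> real ^ 'n \<Rightarrow> real ^ 'm \<Rightarrow> real"
  where "sol_dist \<phi> g zs z lam = infdist (z, lam) ({zs} \<times> multipliers \<phi> g zs)"

definition active :: "(real ^ 'n \<Rightarrow> real ^ 'm) \<Rightarrow> real ^ 'n \<Rightarrow> 'm set"
  where "active g zs = {i. g zs $ i = 0}"

definition active_pos ::
    "(real ^ 'n \<Rightarrow> real) \<Rightarrow> (real ^ 'n \<Rightarrow> real ^ 'm) \<Rightarrow> real ^ 'n \<Rightarrow> 'm set"
  where "active_pos \<phi> g zs = {i \<in> active g zs. \<exists>lam\<in>multipliers \<phi> g zs. lam $ i > 0}"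

definition MFCQ :: "(real ^ 'n \<Rightarrow> real ^ 'm) \<Rightarrow> real ^ 'n \<Rightarrow> bool"
  where "MFCQ g zs \<longleftrightarrow> (\<exists>y. \<forall>i\<in>active g zs. column i (grads g zs) \<bullet> y < 0)"

definition second_order_conditions ::
    "(real ^ 'n \<Rightarrow> real) \<Rightarrow> (real ^ 'n \<Rightarrow> real ^ 'm) \<Rightarrow> real ^ 'n \<Rightarrow> bool"
  where "second_order_conditions \<phi> g zs \<longleftrightarrow>
    (\<exists>\<xi>>0. \<forall>lam\<in>multipliers \<phi> g zs. \<forall>w.
      (\<forall>i\<in>active_pos \<phi> g zs. column i (grads g zs) \<bullet> w = 0) \<and>
      (\<forall>i\<in>active g zs - active_pos \<phi> g zs. column i (grads g zs) \<bullet> w \<le> 0) \<longrightarrow>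
      w \<bullet> (lagr_zz \<phi> g zs lam *v w) \<ge> \<xi> * (norm w)\<^sup>2)"

definition strict_complementarity ::
    "(real ^ 'n \<Rightarrow> real) \<Rightarrow> (real ^ 'n \<Rightarrow> real ^ 'm) \<Rightarrow> real ^ 'n \<Rightarrow> bool"
  where "strict_complementarity \<phi> g zs \<longleftrightarrow>
    (\<exists>lam\<in>multipliers \<phi> g zs. \<forall>i\<in>active g zs. lam $ i > 0)"

definition compl_gap :: "real ^ 'm \<Rightarrow> real ^ 'm \<Rightarrow> real"
  where "compl_gap lam s = (lam \<bullet> s) / real CARD('m)"

text \<open>Positivity is spelled out componentwise because \<open><\<close> on vectors is not componentwise strict.\<close>

definition centrality ::
    "(real ^ 'n \<Rightarrow> real) \<Rightarrow> (real ^ 'n \<Rightarrow> real ^ 'm) \<Rightarrow> real \<Rightarrow> real \<Rightarrow>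
      real ^ 'n \<Rightarrow> real ^ 'm \<Rightarrow> real ^ 'm \<Rightarrow> bool"
  where "centrality \<phi> g C \<gamma> z lam s \<longleftrightarrow>
    norm (lagr_z \<phi> g z lam) \<le> C * compl_gap lam s \<and>
    norm (g z + s) \<le> C * compl_gap lam s \<and>
    (\<forall>i. lam $ i > 0 \<and> s $ i > 0) \<and>
    (\<forall>i. lam $ i * s $ i \<ge> \<gamma> * compl_gap lam s)"

definition diag :: "real ^ 'm \<Rightarrow> real ^ 'm ^ 'm"
  where "diag v = (\<chi> i j. if i = j then v $ i else 0)"

text \<open>The three block rows of the perturbed primal-dual step equations. The constant vector \<open>1\<close> is the paper's \<open>e\<close>.\<close>

definition step_equations ::
    "(real ^ 'n \<Rightarrow> real) \<Rightarrow> (real ^ 'n \<Rightarrow> real ^ 'm) \<Rightarrow>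
      real ^ 'n \<Rightarrow> real ^ 'm \<Rightarrow> real ^ 'm \<Rightarrow> real ^ 'm \<Rightarrow>
      (real ^ 'n) \<times> (real ^ 'm) \<times> (real ^ 'm) \<Rightarrow> bool"
  where "step_equations \<phi> g z lam s t d \<longleftrightarrow> (case d of (dz, dlam, ds) \<Rightarrow>
    lagr_zz \<phi> g z lam *v dz + grads g z *v dlam = - lagr_z \<phi> g z lam \<and>
    transpose (grads g z) *v dz + ds = - (g z + s) \<and>
    diag s *v dlam + diag lam *v ds = - ((diag s ** diag lam) *v 1 + t))"

end

(*
  Let d = z - zs, and let B be the set of active constraints. By strict complementarity and the
  second-order conditions, the Hessian of the Lagrangian is positive definite on the common kernel
  of the active gradients, for every multiplier. Three bounds are each obtained by rescaling a
  sequence of counterexamples and passing to the limit.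

  (1) sum_B s_i + |d|^2 = O(mu): expand (lam - lb)^T (s + g(zs)) to second order in d, where lb is
  a strictly complementary multiplier. With centrality, lam_B is then bounded away from 0.

  (2) d = O(mu): rescale d together with the part u of lam - lb that is orthogonal to the
  directions in which the multipliers are not determined; the limit (x, y) satisfies
  L_zz x + grad g y = 0 with x in the critical space, so x = 0 and then y = 0.

  (3) Rescale the step to norm 1. The limit system gives the primal and slack components 0, and
  grad g y = 0 for the dual component y. Testing the rows with y / mu removes the first-order part
  of g_B(z), because y annihilates the active gradients at zs; the remainders are small because
  d = O(mu) and t = O(mu^2), and what is left is a positive definite form in y.
*)

theory Submission
  imports Defs
begin

section \<open>Gradients, Hessians and Taylor expansion\<close>

lemma has_derivative_grad:
  fixes f :: "real ^ 'n \<Rightarrow> real"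
  assumes "f differentiable (at z)"
  shows "(f has_derivative (\<lambda>h. grad f z \<bullet> h)) (at z)"
proof -
  have d: "(f has_derivative frechet_derivative f (at z)) (at z)"
    using assms frechet_derivative_works by blast
  then interpret linear "frechet_derivative f (at z)"
    using has_derivative_linear by blast
  have "frechet_derivative f (at z) = (\<lambda>h. grad f z \<bullet> h)"
  proof
    fix h :: "real ^ 'n"
    have "frechet_derivative f (at z) h = frechet_derivative f (at z) (\<Sum>i\<in>UNIV. h $ i *s axis i 1)"
      by (simp add: basis_expansion)
    also have "\<dots> = grad f z \<bullet> h"
      by (simp add: sum scaleR scalar_mult_eq_scaleR grad_def inner_vec_def mult.commute)
    finally show "frechet_derivative f (at z) h = grad f z \<bullet> h" .
  qed
  with d show ?thesis by simp
qed

lemma grad_eqI: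
  fixes f :: "real ^ 'n \<Rightarrow> real"
  assumes "(f has_derivative (\<lambda>h. v \<bullet> h)) (at z)"
  shows "grad f z = v"
  using frechet_derivative_at[OF assms, symmetric]
  by (simp add: grad_def vec_eq_iff inner_axis)

lemma hessian_eqI:
  fixes f :: "real ^ 'n \<Rightarrow> real"
  assumes "(grad f has_derivative (\<lambda>h. A *v h)) (at z)"
  shows "hessian f z = A"
  using frechet_derivative_at[OF assms, symmetric]
  by (simp add: hessian_def jacobian_def)

lemma twice_lipschitz_diffD:
  fixes f :: "real ^ 'n \<Rightarrow> real"
  assumes "twice_lipschitz_diff f"
  shows "(f has_derivative (\<lambda>h. grad f z \<bullet> h)) (at z)"
    and "(grad f has_derivative (\<lambda>h. hessian f z *v h)) (at z)"
    and "isCont f z" "isCont (grad f) z" "isCont (hessian f) z"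
proof -
  show f: "(f has_derivative (\<lambda>h. grad f z \<bullet> h)) (at z)"
    using assms by (simp add: twice_lipschitz_diff_def has_derivative_grad)
  show g: "(grad f has_derivative (\<lambda>h. hessian f z *v h)) (at z)"
    using assms by (simp add: twice_lipschitz_diff_def hessian_def flip: jacobian_works)
  show "isCont f z" "isCont (grad f) z"
    by (rule has_derivative_continuous[OF f], rule has_derivative_continuous[OF g])
  obtain r L where "r > 0" "L-lipschitz_on (cball z r) (hessian f)"
    using assms by (meson twice_lipschitz_diff_def)
  then have "continuous_on (ball z r) (hessian f)"
    by (meson lipschitz_on_continuous_on continuous_on_subset ball_subset_cball)
  then show "isCont (hessian f) z"
    using \<open>r > 0\<close> by (simp add: continuous_on_eq_continuous_at)
qed

lemma grad_expansion:
  fixes f :: "real ^ 'n \<Rightarrow> real"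
  assumes "twice_lipschitz_diff f" "e > 0"
  shows "\<exists>\<delta>>0. \<forall>z. norm (z - a) < \<delta> \<longrightarrow>
    norm (grad f z - grad f a - hessian f a *v (z - a)) \<le> e * norm (z - a)"
  using twice_lipschitz_diffD(2)[OF assms(1), of a] assms(2) unfolding has_derivative_at_alt by blast

text \<open>The Hessian is not known to be symmetric here, so the remainder is differentiated along the
  segment from \<open>a\<close> to \<open>z\<close> only.\<close>

lemma second_order_expansion:
  fixes f :: "real ^ 'n \<Rightarrow> real"
  assumes f: "twice_lipschitz_diff f" and "e > 0"
  shows "\<exists>\<delta>>0. \<forall>z. norm (z - a) < \<delta> \<longrightarrow>
    norm (f z - f a - grad f a \<bullet> (z - a) - (z - a) \<bullet> (hessian f a *v (z - a)) / 2)
      \<le> e * (norm (z - a))\<^sup>2"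
proof -
  obtain \<delta> where "\<delta> > 0" and \<delta>: "\<And>z. norm (z - a) < \<delta> \<Longrightarrow>
    norm (grad f z - grad f a - hessian f a *v (z - a)) \<le> e * norm (z - a)"
    using grad_expansion[OF assms] by blast
  have "norm (f z - f a - grad f a \<bullet> d - d \<bullet> (hessian f a *v d) / 2) \<le> e * (norm d)\<^sup>2"
    if z: "norm (z - a) < \<delta>" and d: "d = z - a" for z d
  proof -
    \<comment> \<open>\<open>h 1 - h 0\<close> is the remainder to be estimated. Along the segment
      the quadratic term has derivative \<open>t * (d \<bullet> (hessian f a *v d))\<close>, with no
      transposed Hessian, so the derivative of \<open>h\<close> is the first-order remainder of
      \<open>grad f\<close> tested with \<open>d\<close>.\<close>
    define h where "h = (\<lambda>t. f (a + t *\<^sub>R d) - t * (grad f a \<bullet> d) - t\<^sup>2 * (d \<bullet> (hessian f a *v d)) / 2)"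
    have "(h has_derivative (\<lambda>s. s * ((grad f (a + t *\<^sub>R d) - grad f a - hessian f a *v (t *\<^sub>R d)) \<bullet> d)))
      (at t within {0..1})" for t
      unfolding h_def
      by (rule has_derivative_at_withinI, rule derivative_eq_intros
          has_derivative_compose[OF _ twice_lipschitz_diffD(1)[OF f]] refl | simp)+
        (simp add: algebra_simps matrix_vector_mult_scaleR inner_commute)
    then obtain t where t: "t \<in> {0<..<1}"
      and h: "h 1 - h 0 = (1 - 0) * ((grad f (a + t *\<^sub>R d) - grad f a - hessian f a *v (t *\<^sub>R d)) \<bullet> d)"
      using mvt_simple[of 0 1 h "\<lambda>t s. s * ((grad f (a + t *\<^sub>R d) - grad f a - hessian f a *v (t *\<^sub>R d)) \<bullet> d)"]
      by auto
    have le: "norm (t *\<^sub>R d) \<le> norm d"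
      using t by (simp add: mult_left_le_one_le)
    then have "norm (grad f (a + t *\<^sub>R d) - grad f a - hessian f a *v (t *\<^sub>R d)) \<le> e * norm (t *\<^sub>R d)"
      using \<delta>[of "a + t *\<^sub>R d"] z d by simp
    also have "\<dots> \<le> e * norm d"
      using le \<open>e > 0\<close> by (simp only: mult_left_mono)
    finally have "norm (h 1 - h 0) \<le> e * norm d * norm d"
      unfolding h using Cauchy_Schwarz_ineq2 mult_right_mono[OF _ norm_ge_zero, of _ "e * norm d" d]
      by (simp add: order_trans[OF Cauchy_Schwarz_ineq2])
    then show ?thesis
      by (simp add: h_def power2_eq_square mult.assoc d algebra_simps)
  qed
  with \<open>\<delta> > 0\<close> show ?thesis by blast
qed

section \<open>Remainders along convergent sequences\<close>

text \<open>The scale \<open>\<rho>\<close> only has to dominate the power of the distance. This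
  permits mixed scales, such as a sum of slacks plus a squared distance, or the norm of a
  pair.\<close>

lemma little_o_sequence:
  fixes R :: "'a :: real_normed_vector \<Rightarrow> 'b :: real_normed_vector"
  assumes R: "\<And>e. e > 0 \<Longrightarrow> \<exists>\<delta>>0. \<forall>z. norm (z - a) < \<delta> \<longrightarrow> norm (R z) \<le> e * norm (z - a) ^ p"
    and Z: "Z \<longlonglongrightarrow> a" and \<rho>: "\<And>n. norm (Z n - a) ^ p \<le> \<rho> n"
  shows "(\<lambda>n. R (Z n) /\<^sub>R \<rho> n) \<longlonglongrightarrow> 0"
proof (rule tendstoI)
  fix e :: real assume "e > 0"
  then obtain \<delta> where "\<delta> > 0"
    and \<delta>: "\<And>z. norm (z - a) < \<delta> \<Longrightarrow> norm (R z) \<le> e / 2 * norm (z - a) ^ p"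
    using R[of "e / 2"] by auto
  have "eventually (\<lambda>n. dist (Z n) a < \<delta>) sequentially"
    using Z \<open>\<delta> > 0\<close> by (rule tendstoD)
  then show "eventually (\<lambda>n. dist (R (Z n) /\<^sub>R \<rho> n) 0 < e) sequentially"
  proof eventually_elim
    case (elim n)
    then have "norm (R (Z n)) \<le> e / 2 * norm (Z n - a) ^ p"
      using \<delta> by (simp add: dist_norm)
    also have "\<dots> \<le> e / 2 * \<rho> n"
      using \<open>e > 0\<close> \<rho> by (intro mult_left_mono) auto
    finally have le: "norm (R (Z n)) \<le> e / 2 * \<rho> n" .
    have "\<rho> n \<ge> 0"
      using \<rho>[of n] by (meson norm_ge_zero order_trans zero_le_power)
    show ?case
    \<comment> \<open>For \<open>\<rho> n = 0\<close> the scaled term is 0 because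
      \<open>inverse 0 = 0\<close>.\<close>
    proof (cases "\<rho> n = 0")
      case False
      with \<open>\<rho> n \<ge> 0\<close> \<open>e > 0\<close> have "e * \<rho> n > 0" "\<rho> n > 0" by auto
      with le show ?thesis by (simp add: divide_inverse_commute[symmetric] pos_divide_less_eq)
    qed (use \<open>e > 0\<close> in simp)
  qed
qed

text \<open>Explicit constants replace the little-o terms: once \<open>z - a\<close> is of order
  \<open>\<mu>\<close>, the gradient difference is of order \<open>\<mu>\<close> and the first-order
  remainder of order \<open>\<mu>\<^sup>2\<close>. Both expansions are taken with error constant 1,
  and the Hessian at \<open>a\<close> is absorbed through its operator bound.\<close>

lemma locally_lipschitz_at_grad:
  fixes f :: "real ^ 'n \<Rightarrow> real"
  assumes "twice_lipschitz_diff f"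
  shows "\<exists>\<delta>>0. \<exists>M>0. \<forall>z. norm (z - a) < \<delta> \<longrightarrow>
    norm (grad f z - grad f a) \<le> M * norm (z - a) \<and>
    \<bar>f z - f a - grad f a \<bullet> (z - a)\<bar> \<le> M * (norm (z - a))\<^sup>2"
proof -
  obtain \<delta>1 where 1: "\<delta>1 > 0" "\<And>z. norm (z - a) < \<delta>1 \<Longrightarrow>
    norm (grad f z - grad f a - hessian f a *v (z - a)) \<le> 1 * norm (z - a)"
    using grad_expansion[OF assms, of 1 a] by auto
  obtain \<delta>2 where 2: "\<delta>2 > 0" "\<And>z. norm (z - a) < \<delta>2 \<Longrightarrow>
    norm (f z - f a - grad f a \<bullet> (z - a) - (z - a) \<bullet> (hessian f a *v (z - a)) / 2) \<le> 1 * (norm (z - a))\<^sup>2"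
    using second_order_expansion[OF assms, of 1 a] by auto
  obtain M where M: "M > 0" "\<And>x. norm (hessian f a *v x) \<le> norm x * M"
    using bounded_linear.pos_bounded[OF matrix_vector_mul_bounded_linear[of "hessian f a"]] by auto
  have "norm (grad f z - grad f a) \<le> (M + 1) * norm (z - a) \<and>
    \<bar>f z - f a - grad f a \<bullet> (z - a)\<bar> \<le> (M + 1) * (norm (z - a))\<^sup>2"
    if z: "norm (z - a) < min \<delta>1 \<delta>2" for z
  proof
    show "norm (grad f z - grad f a) \<le> (M + 1) * norm (z - a)"
      using norm_triangle_sub[of "grad f z - grad f a" "hessian f a *v (z - a)"]
        1(2)[of z] M(2)[of "z - a"] z by (simp add: algebra_simps)
    have "\<bar>(z - a) \<bullet> (hessian f a *v (z - a))\<bar> \<le> norm (z - a) * (norm (z - a) * M)"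
      using Cauchy_Schwarz_ineq2 M(2) by (meson mult_left_mono norm_ge_zero order_trans)
    moreover have "\<bar>(z - a) \<bullet> (hessian f a *v (z - a)) / 2\<bar> \<le> \<bar>(z - a) \<bullet> (hessian f a *v (z - a))\<bar>"
      by simp
    ultimately show "\<bar>f z - f a - grad f a \<bullet> (z - a)\<bar> \<le> (M + 1) * (norm (z - a))\<^sup>2"
      using 2(2)[of z] z unfolding real_norm_def power2_eq_square by (simp add: distrib_right mult.commute mult.left_commute)
  qed
  then show ?thesis
    using 1(1) 2(1) M(1) by (intro exI[of _ "min \<delta>1 \<delta>2"] conjI exI[of _ "M + 1"]) auto
qed

lemma tendsto_matrix_vector_mult [tendsto_intros]:
  fixes A :: "'a \<Rightarrow> real ^ 'n ^ 'm"
  assumes "(A \<longlongrightarrow> A0) F" "(x \<longlongrightarrow> x0) F"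
  shows "((\<lambda>n. A n *v x n) \<longlongrightarrow> A0 *v x0) F"
  using assms unfolding matrix_vector_mult_def by (intro tendsto_intros)

lemma matrix_vector_mult_sum_left: "(\<Sum>i\<in>I. A i) *v x = (\<Sum>i\<in>I. A i *v (x :: real ^ 'n))"
  for A :: "_ \<Rightarrow> real ^ 'n ^ 'k"
  by (induction I rule: infinite_finite_induct) (simp_all add: matrix_vector_mult_add_rdistrib)

lemma diag_mult_nth: "(diag v *v x) $ i = v $ i * x $ i"
  by (simp add: diag_def matrix_vector_mult_def if_distrib[of "\<lambda>c. c * _"] cong: if_cong)

text \<open>Centrality bounds the residuals by a multiple of \<open>\<mu>\<close>, so they disappear
  in the limit under every rescaling that dominates \<open>\<mu>\<close>.\<close>

lemma tendsto_scaled_residual: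
  fixes v :: "nat \<Rightarrow> 'b :: real_normed_vector"
  assumes "\<And>n. norm (v n) \<le> c * \<mu> n" "\<And>n. \<rho> n > 0" "(\<lambda>n. \<mu> n / \<rho> n) \<longlonglongrightarrow> 0"
  shows "(\<lambda>n. v n /\<^sub>R \<rho> n) \<longlonglongrightarrow> 0"
proof (rule Lim_null_comparison)
  have "norm (v n /\<^sub>R \<rho> n) \<le> c * (\<mu> n / \<rho> n)" for n
  proof -
    have "norm (v n /\<^sub>R \<rho> n) = norm (v n) / \<rho> n"
      using assms(2)[of n] by (simp add: divide_inverse_commute)
    also have "\<dots> \<le> c * \<mu> n / \<rho> n"
      using assms(1)[of n] assms(2)[of n] by (intro divide_right_mono) simp_all
    finally show ?thesis by simp
  qed
  then show "\<forall>\<^sub>F n in sequentially. norm (v n /\<^sub>R \<rho> n) \<le> c * (\<mu> n / \<rho> n)"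
    by simp
  show "(\<lambda>n. c * (\<mu> n / \<rho> n)) \<longlonglongrightarrow> 0"
    using tendsto_mult_right_zero[OF assms(3)] .
qed

section \<open>The Lagrangian near a point\<close>

locale smooth_nlp =
  fixes \<phi> :: "real ^ 'n \<Rightarrow> real" and g :: "real ^ 'n \<Rightarrow> real ^ 'm"
  assumes smooth_objective: "twice_lipschitz_diff \<phi>"
    and smooth_constraint: "\<And>i. twice_lipschitz_diff (\<lambda>z. g z $ i)"
begin

abbreviation dg :: "'m \<Rightarrow> real ^ 'n \<Rightarrow> real ^ 'n"
  where "dg i \<equiv> grad (\<lambda>y. g y $ i)"

abbreviation ddg :: "'m \<Rightarrow> real ^ 'n \<Rightarrow> real ^ 'n ^ 'n"
  where "ddg i \<equiv> hessian (\<lambda>y. g y $ i)"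

lemma column_grads: "column i (grads g z) = dg i z"
  by (simp add: column_def grads_def vec_eq_iff)

lemma grads_mult: "grads g z *v v = (\<Sum>i\<in>UNIV. v $ i *\<^sub>R dg i z)"
  by (simp add: grads_def matrix_vector_mult_def vec_eq_iff mult.commute)

lemma transpose_grads_mult_nth: "(transpose (grads g z) *v x) $ i = dg i z \<bullet> x"
  by (simp add: grads_def matrix_vector_mult_def transpose_def inner_vec_def)

lemma inner_grads_mult: "x \<bullet> (grads g z *v v) = (\<Sum>i\<in>UNIV. v $ i * (dg i z \<bullet> x))"
  by (simp add: grads_mult inner_sum_right inner_commute)

lemma lagr_z_eq: "lagr_z \<phi> g z lam = grad \<phi> z + grads g z *v lam"
  unfolding lagr_z_def grads_mult lagrangian_def
proof (rule grad_eqI)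
  have "((\<lambda>y. \<phi> y + (\<Sum>i\<in>UNIV. lam $ i * g y $ i)) has_derivative
    (\<lambda>h. grad \<phi> z \<bullet> h + (\<Sum>i\<in>UNIV. lam $ i * (dg i z \<bullet> h)))) (at z)"
    by (intro has_derivative_add has_derivative_sum has_derivative_mult_right
        twice_lipschitz_diffD(1) smooth_objective smooth_constraint)
  then show "((\<lambda>y. \<phi> y + lam \<bullet> g y) has_derivative
    (\<lambda>h. (grad \<phi> z + (\<Sum>i\<in>UNIV. lam $ i *\<^sub>R dg i z)) \<bullet> h)) (at z)"
    by (simp add: inner_vec_def[of lam] inner_add_left inner_sum_left)
qed

lemma lagr_zz_eq: "lagr_zz \<phi> g z lam = hessian \<phi> z + (\<Sum>i\<in>UNIV. lam $ i *\<^sub>R ddg i z)"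
  unfolding lagr_zz_def
proof (rule hessian_eqI)
  have "grad (\<lambda>y. lagrangian \<phi> g y lam) = (\<lambda>z. grad \<phi> z + (\<Sum>i\<in>UNIV. lam $ i *\<^sub>R dg i z))"
    using lagr_z_eq by (simp add: fun_eq_iff lagr_z_def grads_mult)
  moreover have "((\<lambda>z. grad \<phi> z + (\<Sum>i\<in>UNIV. lam $ i *\<^sub>R dg i z)) has_derivative
    (\<lambda>h. hessian \<phi> z *v h + (\<Sum>i\<in>UNIV. lam $ i *\<^sub>R (ddg i z *v h)))) (at z)"
    by (intro has_derivative_add has_derivative_sum has_derivative_scaleR_right
        twice_lipschitz_diffD(2) smooth_objective smooth_constraint)
  moreover have "(\<lambda>h. hessian \<phi> z *v h + (\<Sum>i\<in>UNIV. lam $ i *\<^sub>R (ddg i z *v h)))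
    = (*v) (hessian \<phi> z + (\<Sum>i\<in>UNIV. lam $ i *\<^sub>R ddg i z))"
    by (simp add: fun_eq_iff matrix_vector_mult_add_rdistrib matrix_vector_mult_sum_left
        scaleR_matrix_vector_assoc)
  ultimately show "(grad (\<lambda>y. lagrangian \<phi> g y lam) has_derivative
    (*v) (hessian \<phi> z + (\<Sum>i\<in>UNIV. lam $ i *\<^sub>R ddg i z))) (at z)"
    by simp
qed

lemma lagr_zz_mult: "lagr_zz \<phi> g z lam *v x = hessian \<phi> z *v x + (\<Sum>i\<in>UNIV. lam $ i *\<^sub>R (ddg i z *v x))"
  by (simp add: lagr_zz_eq matrix_vector_mult_add_rdistrib matrix_vector_mult_sum_left
      scaleR_matrix_vector_assoc)

context
  fixes Z :: "nat \<Rightarrow> real ^ 'n" and z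
  assumes Z: "Z \<longlonglongrightarrow> z"
begin

lemma tendsto_constraint: "(\<lambda>n. g (Z n) $ i) \<longlonglongrightarrow> g z $ i"
  using twice_lipschitz_diffD(3)[OF smooth_constraint] Z by (rule isCont_tendsto_compose)

lemma tendsto_dg: "(\<lambda>n. dg i (Z n)) \<longlonglongrightarrow> dg i z"
  using twice_lipschitz_diffD(4)[OF smooth_constraint] Z by (rule isCont_tendsto_compose)

lemma tendsto_grads: "(\<lambda>n. grads g (Z n)) \<longlonglongrightarrow> grads g z"
  unfolding grads_def by (intro tendsto_intros tendsto_vec_nth tendsto_dg)

lemma tendsto_constraint_remainder:
  assumes "\<And>n. norm (Z n - z) \<le> \<tau> n"
  shows "(\<lambda>n. (g (Z n) $ i - g z $ i - dg i z \<bullet> (Z n - z)) / \<tau> n) \<longlonglongrightarrow> 0"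
proof -
  have "(\<lambda>n. (\<lambda>y. g y $ i - g z $ i - dg i z \<bullet> (y - z)) (Z n) /\<^sub>R \<tau> n) \<longlonglongrightarrow> 0"
    using assms twice_lipschitz_diffD(1)[OF smooth_constraint, of i z]
    by (intro little_o_sequence[OF _ Z, where p = 1]) (auto simp: has_derivative_at_alt)
  then show ?thesis by (simp add: divide_inverse mult.commute)
qed

context
  fixes L :: "nat \<Rightarrow> real ^ 'm" and l
  assumes L: "L \<longlonglongrightarrow> l"
begin

lemma tendsto_lagr_zz: "(\<lambda>n. lagr_zz \<phi> g (Z n) (L n)) \<longlonglongrightarrow> lagr_zz \<phi> g z l"
  unfolding lagr_zz_eq
  by (intro tendsto_intros tendsto_vec_nth L
      isCont_tendsto_compose[OF twice_lipschitz_diffD(5) Z] smooth_objective smooth_constraint)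

text \<open>Expanding at \<open>(z, L n)\<close> rather than at \<open>(z, l)\<close> leaves no
  error from the multiplier. The Lagrangian is affine in the multiplier, so the remainder is that of
  \<open>\<phi>\<close> plus those of the constraints, weighted by the convergent coefficients
  \<open>L n $ i\<close>.\<close>

lemma tendsto_lagr_z_remainder:
  assumes "\<And>n. norm (Z n - z) \<le> \<tau> n"
  shows "(\<lambda>n. (lagr_z \<phi> g (Z n) (L n) - lagr_z \<phi> g z (L n) - lagr_zz \<phi> g z (L n) *v (Z n - z)) /\<^sub>R \<tau> n) \<longlonglongrightarrow> 0"
proof -
  define R where "R f = (\<lambda>y. grad f y - grad f z - hessian f z *v (y - z))" for f
  have R: "(\<lambda>n. R f (Z n) /\<^sub>R \<tau> n) \<longlonglongrightarrow> 0" if "twice_lipschitz_diff f" for f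
    using assms grad_expansion[OF that] by (intro little_o_sequence[OF _ Z, where p = 1]) (auto simp: R_def)
  have "(\<lambda>n. R \<phi> (Z n) /\<^sub>R \<tau> n + (\<Sum>i\<in>UNIV. L n $ i *\<^sub>R (R (\<lambda>y. g y $ i) (Z n) /\<^sub>R \<tau> n)))
    \<longlonglongrightarrow> 0 + (\<Sum>i\<in>UNIV. l $ i *\<^sub>R 0)"
    by (intro tendsto_intros R smooth_objective smooth_constraint tendsto_vec_nth L)
  moreover have "R \<phi> (Z n) /\<^sub>R \<tau> n + (\<Sum>i\<in>UNIV. L n $ i *\<^sub>R (R (\<lambda>y. g y $ i) (Z n) /\<^sub>R \<tau> n))
    = (lagr_z \<phi> g (Z n) (L n) - lagr_z \<phi> g z (L n) - lagr_zz \<phi> g z (L n) *v (Z n - z)) /\<^sub>R \<tau> n" for n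
    unfolding lagr_z_eq lagr_zz_mult grads_mult R_def
    by (simp add: algebra_simps sum.distrib sum_subtractf scaleR_sum_right)
  ultimately show ?thesis by simp
qed

text \<open>The same decomposition one order higher; the scale now dominates the squared
  distance.\<close>

lemma tendsto_lagrangian_remainder:
  assumes "\<And>n. (norm (Z n - z))\<^sup>2 \<le> \<rho> n"
  shows "(\<lambda>n. (lagrangian \<phi> g (Z n) (L n) - lagrangian \<phi> g z (L n) - lagr_z \<phi> g z (L n) \<bullet> (Z n - z)
    - (Z n - z) \<bullet> (lagr_zz \<phi> g z (L n) *v (Z n - z)) / 2) / \<rho> n) \<longlonglongrightarrow> 0"
proof -
  define R where "R f = (\<lambda>y. f y - f z - grad f z \<bullet> (y - z) - (y - z) \<bullet> (hessian f z *v (y - z)) / 2)"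
    for f :: "real ^ 'n \<Rightarrow> real"
  have R: "(\<lambda>n. R f (Z n) /\<^sub>R \<rho> n) \<longlonglongrightarrow> 0" if "twice_lipschitz_diff f" for f
    using assms second_order_expansion[OF that]
    by (intro little_o_sequence[OF _ Z, where p = 2]) (auto simp: R_def)
  have "(\<lambda>n. R \<phi> (Z n) /\<^sub>R \<rho> n + (\<Sum>i\<in>UNIV. L n $ i *\<^sub>R (R (\<lambda>y. g y $ i) (Z n) /\<^sub>R \<rho> n)))
    \<longlonglongrightarrow> 0 + (\<Sum>i\<in>UNIV. l $ i *\<^sub>R 0)"
    by (intro tendsto_intros R smooth_objective smooth_constraint tendsto_vec_nth L)
  moreover have "R \<phi> (Z n) /\<^sub>R \<rho> n + (\<Sum>i\<in>UNIV. L n $ i *\<^sub>R (R (\<lambda>y. g y $ i) (Z n) /\<^sub>R \<rho> n))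
    = (lagrangian \<phi> g (Z n) (L n) - lagrangian \<phi> g z (L n) - lagr_z \<phi> g z (L n) \<bullet> (Z n - z)
    - (Z n - z) \<bullet> (lagr_zz \<phi> g z (L n) *v (Z n - z)) / 2) / \<rho> n" for n
  proof -
    have "(\<Sum>i\<in>UNIV. L n $ i * R (\<lambda>y. g y $ i) (Z n)) = L n \<bullet> g (Z n) - L n \<bullet> g z
      - (\<Sum>i\<in>UNIV. L n $ i * (dg i z \<bullet> (Z n - z)))
      - (\<Sum>i\<in>UNIV. L n $ i * ((Z n - z) \<bullet> (ddg i z *v (Z n - z)))) / 2"
      by (simp add: R_def inner_vec_def[of "L n"] right_diff_distrib sum_subtractf sum_divide_distrib)
    moreover have "(Z n - z) \<bullet> (lagr_zz \<phi> g z (L n) *v (Z n - z)) =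
      (Z n - z) \<bullet> (hessian \<phi> z *v (Z n - z)) +
      (\<Sum>i\<in>UNIV. L n $ i * ((Z n - z) \<bullet> (ddg i z *v (Z n - z))))"
      by (simp add: lagr_zz_mult inner_add_right inner_sum_right)
    moreover have "lagr_z \<phi> g z (L n) \<bullet> (Z n - z) =
      grad \<phi> z \<bullet> (Z n - z) + (\<Sum>i\<in>UNIV. L n $ i * (dg i z \<bullet> (Z n - z)))"
      by (simp add: lagr_z_eq grads_mult inner_add_left inner_sum_left)
    ultimately have "R \<phi> (Z n) + (\<Sum>i\<in>UNIV. L n $ i * R (\<lambda>y. g y $ i) (Z n)) =
      lagrangian \<phi> g (Z n) (L n) - lagrangian \<phi> g z (L n) - lagr_z \<phi> g z (L n) \<bullet> (Z n - z)
      - (Z n - z) \<bullet> (lagr_zz \<phi> g z (L n) *v (Z n - z)) / 2"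
      unfolding R_def[of \<phi>] lagrangian_def by linarith
    moreover have "R \<phi> (Z n) /\<^sub>R \<rho> n + (\<Sum>i\<in>UNIV. L n $ i *\<^sub>R (R (\<lambda>y. g y $ i) (Z n) /\<^sub>R \<rho> n))
      = (R \<phi> (Z n) + (\<Sum>i\<in>UNIV. L n $ i * R (\<lambda>y. g y $ i) (Z n))) / \<rho> n"
      by (simp add: divide_inverse distrib_left sum_distrib_left mult.commute mult.left_commute)
    ultimately show ?thesis by simp
  qed
  ultimately show ?thesis by simp
qed

end

end

section \<open>The set of multipliers\<close>

text \<open>All terms \<open>lam $ j * g z $ j\<close> have the same sign, so a vanishing sum makes
  each of them vanish.\<close>

lemma KKT_complementary:
  assumes "lam \<in> multipliers \<phi> g z" "i \<notin> active g z"
  shows "lam $ i = 0"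
proof -
  have "(\<Sum>j\<in>UNIV. lam $ j * - g z $ j) = 0"
    using assms(1) by (simp add: multipliers_def KKT_def inner_vec_def sum_negf)
  moreover have "lam $ j * - g z $ j \<ge> 0" for j
    using assms(1) by (simp add: multipliers_def KKT_def mult_nonneg_nonpos)
  ultimately have "lam $ i * - g z $ i = 0"
    by (simp add: sum_nonneg_eq_0_iff)
  then show ?thesis
    using assms(2) by (simp add: active_def)
qed

lemma closed_multipliers: "closed (multipliers \<phi> g z)"
proof -
  have "multipliers \<phi> g z = {lam. grad \<phi> z + grads g z *v lam = 0} \<inter> {lam. \<forall>i. g z $ i \<le> 0}
    \<inter> (\<Inter>i. {lam. 0 \<le> lam $ i}) \<inter> {lam. lam \<bullet> g z = 0}"
    by (auto simp: multipliers_def KKT_def lagr_z_eq)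
  moreover have "closed \<dots>"
    by (intro closed_Int closed_INT ballI closed_Collect_eq closed_Collect_le closed_Collect_const continuous_intros
        matrix_vector_mult_linear_continuous_on)
  ultimately show ?thesis by simp
qed

text \<open>Testing stationarity with the MFCQ direction \<open>y\<close> writes
  \<open>grad \<phi> z \<bullet> y\<close> as a combination of the multipliers with coefficients
  \<open>- (dg i z \<bullet> y)\<close>, which are positive on the active set. The multipliers are
  nonnegative, so each active one is bounded by a quotient, and the inactive ones vanish.\<close>

lemma bounded_multipliers:
  assumes "MFCQ g z"
  shows "bounded (multipliers \<phi> g z)"
proof -
  obtain y where y: "\<And>i. i \<in> active g z \<Longrightarrow> dg i z \<bullet> y < 0"
    using assms by (auto simp: MFCQ_def column_grads)
  \<comment> \<open>Summing the individual bounds gives one constant for all indices; it is 0, and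
    still correct, when no constraint is active.\<close>
  define c where "c = (\<Sum>i\<in>active g z. \<bar>grad \<phi> z \<bullet> y\<bar> / (- (dg i z \<bullet> y)))"
  have "norm lam \<le> (\<Sum>i\<in>(UNIV :: 'm set). c)" if lam: "lam \<in> multipliers \<phi> g z" for lam
  proof -
    have "lam $ i \<ge> 0" for i
      using lam by (simp add: multipliers_def KKT_def)
    have "y \<bullet> (grad \<phi> z + grads g z *v lam) = 0"
      using lam by (simp add: multipliers_def KKT_def lagr_z_eq)
    then have sum: "(\<Sum>i\<in>UNIV. lam $ i * - (dg i z \<bullet> y)) = grad \<phi> z \<bullet> y"
      by (simp add: inner_add_right inner_grads_mult sum_negf inner_commute)
    have nonneg: "lam $ i * - (dg i z \<bullet> y) \<ge> 0" for i
      using y[of i] KKT_complementary[OF lam, of i] \<open>lam $ i \<ge> 0\<close>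
      by (cases "i \<in> active g z") (auto simp: mult_nonneg_nonpos less_imp_le)
    have "\<bar>lam $ i\<bar> \<le> c" for i
    proof (cases "i \<in> active g z")
      case True
      have "lam $ i * - (dg i z \<bullet> y) \<le> grad \<phi> z \<bullet> y"
        unfolding sum[symmetric] using nonneg by (intro member_le_sum) auto
      then have "lam $ i \<le> \<bar>grad \<phi> z \<bullet> y\<bar> / (- (dg i z \<bullet> y))"
        using y[OF True] by (subst pos_le_divide_eq) auto
      also have "\<dots> \<le> c"
        unfolding c_def using True y
        by (intro member_le_sum[where f = "\<lambda>i. \<bar>grad \<phi> z \<bullet> y\<bar> / (- (dg i z \<bullet> y))"])
          (auto intro!: divide_nonneg_neg)
      finally show ?thesis using \<open>lam $ i \<ge> 0\<close> by simp
    next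
      case False
      then show ?thesis
        using KKT_complementary[OF lam] y by (auto simp: c_def intro!: sum_nonneg divide_nonneg_neg)
    qed
    then show ?thesis
      using norm_le_l1_cart[of lam] by (meson order_trans sum_mono)
  qed
  then show ?thesis by (auto simp: bounded_iff)
qed

end

section \<open>Central sequences converging to the solution set\<close>

locale degenerate_nlp = smooth_nlp \<phi> g
  for \<phi> :: "real ^ 'n \<Rightarrow> real" and g :: "real ^ 'n \<Rightarrow> real ^ 'm" +
  fixes zs :: "real ^ 'n" and C \<gamma> :: real
  assumes KKT_point: "\<exists>lam. KKT \<phi> g zs lam"
    and MFCQ: "MFCQ g zs"
    and second_order: "second_order_conditions \<phi> g zs"
    and strict_complementarity: "strict_complementarity \<phi> g zs"
    and \<gamma>_pos: "\<gamma> > 0"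
begin

abbreviation mults :: "(real ^ 'm) set"
  where "mults \<equiv> multipliers \<phi> g zs"

abbreviation act :: "'m set"
  where "act \<equiv> active g zs"

lemma multsD:
  assumes "l \<in> mults"
  shows "grad \<phi> zs + grads g zs *v l = 0" "l $ i \<ge> 0" "l \<bullet> g zs = 0"
  using assms by (simp_all add: multipliers_def KKT_def lagr_z_eq)

lemma feasible: "g zs $ i \<le> 0"
  using KKT_point by (auto simp: KKT_def)

lemma strict_multiplier:
  obtains lb \<beta> where "lb \<in> mults" "\<beta> > 0" "\<And>i. i \<in> act \<Longrightarrow> lb $ i \<ge> \<beta>"
proof -
  obtain lb where lb: "lb \<in> mults" "\<And>i. i \<in> act \<Longrightarrow> lb $ i > 0"
    using strict_complementarity by (auto simp: strict_complementarity_def)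
  \<comment> \<open>Inserting 1 keeps the minimum defined and positive when no constraint is
    active.\<close>
  define \<beta> where "\<beta> = Min (insert 1 ((\<lambda>i. lb $ i) ` act))"
  have "\<beta> > 0" "\<And>i. i \<in> act \<Longrightarrow> lb $ i \<ge> \<beta>"
    using lb by (auto simp: \<beta>_def)
  with lb that show ?thesis by blast
qed

text \<open>A strictly complementary multiplier makes \<open>active_pos\<close> all of
  \<open>act\<close>. The critical cone is then the kernel of the active gradients, and the
  second-order condition becomes positive definiteness on this subspace.\<close>

lemma second_order_critical:
  assumes "l \<in> mults" "\<And>i. i \<in> act \<Longrightarrow> dg i zs \<bullet> w = 0" "w \<noteq> 0"
  shows "w \<bullet> (lagr_zz \<phi> g zs l *v w) > 0"
proof -
  obtain lb \<beta> where "lb \<in> mults" "\<beta> > 0" "\<And>i. i \<in> act \<Longrightarrow> lb $ i \<ge> \<beta>"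
    by (rule strict_multiplier) blast
  then have "active_pos \<phi> g zs = act"
    by (force simp: active_pos_def)
  then obtain \<xi> where "\<xi> > 0" "w \<bullet> (lagr_zz \<phi> g zs l *v w) \<ge> \<xi> * (norm w)\<^sup>2"
    using second_order assms by (auto simp: second_order_conditions_def column_grads)
  then show ?thesis
    using assms(3) by (smt (verit) mult_pos_pos zero_less_norm_iff zero_less_power)
qed

text \<open>Testing the equation with \<open>w\<close> kills the dual term: \<open>v\<close> is
  supported on the active set, where the gradients annihilate \<open>w\<close>. Both limit arguments
  use this to make the primal component vanish.\<close>

lemma second_order_kernel:
  assumes l: "l \<in> mults" and w: "\<And>i. i \<in> act \<Longrightarrow> dg i zs \<bullet> w = 0"
    and v: "\<And>i. i \<notin> act \<Longrightarrow> v $ i = 0"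
    and eq: "lagr_zz \<phi> g zs l *v w + grads g zs *v v = 0"
  shows "w = 0"
proof (rule ccontr)
  assume "w \<noteq> 0"
  have "v $ i * (dg i zs \<bullet> w) = 0" for i
    using w v by (cases "i \<in> act") auto
  then have "w \<bullet> (grads g zs *v v) = 0"
    unfolding inner_grads_mult by (intro sum.neutral) simp
  then have "w \<bullet> (lagr_zz \<phi> g zs l *v w) = 0"
    using arg_cong[OF eq, of "\<lambda>u. w \<bullet> u"] by (simp add: inner_add_right)
  then show False
    using second_order_critical[OF l w \<open>w \<noteq> 0\<close>] by simp
qed

section \<open>Centrality and sequences of counterexamples\<close>

lemma centralityD:
  fixes lam s :: "real ^ 'm"
  assumes "centrality \<phi> g C \<gamma> z lam s"
  shows "norm (lagr_z \<phi> g z lam) \<le> C * compl_gap lam s" "norm (g z + s) \<le> C * compl_gap lam s"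
    "lam $ i > 0" "s $ i > 0" "lam $ i * s $ i \<ge> \<gamma> * compl_gap lam s"
    "lam $ i * s $ i \<le> lam \<bullet> s" "lam \<bullet> s = real CARD('m) * compl_gap lam s" "compl_gap lam s > 0"
proof -
  show *: "norm (lagr_z \<phi> g z lam) \<le> C * compl_gap lam s" "norm (g z + s) \<le> C * compl_gap lam s"
    "lam $ i > 0" "s $ i > 0" "lam $ i * s $ i \<ge> \<gamma> * compl_gap lam s" for i
    using assms by (simp_all add: centrality_def)
  have pos: "0 < lam $ j * s $ j" for j
    using *(3,4)[of j] by simp
  show le: "lam $ i * s $ i \<le> lam \<bullet> s"
    unfolding inner_vec_def inner_real_def
    by (rule member_le_sum) (simp_all add: pos less_imp_le)
  show "compl_gap lam s > 0"
    unfolding compl_gap_def using less_le_trans[OF pos le] by simp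
  show "lam \<bullet> s = real CARD('m) * compl_gap lam s"
    by (simp add: compl_gap_def)
qed

text \<open>Convergence of the slacks is not part of the notion, since it follows; see
  \<open>tendsto_slack\<close>.\<close>

definition central_seq ::
  "(nat \<Rightarrow> real ^ 'n) \<Rightarrow> (nat \<Rightarrow> real ^ 'm) \<Rightarrow> (nat \<Rightarrow> real ^ 'm) \<Rightarrow> real ^ 'm \<Rightarrow> bool"
  where "central_seq Z L S l \<longleftrightarrow> (\<forall>n. centrality \<phi> g C \<gamma> (Z n) (L n) (S n)) \<and>
    Z \<longlonglongrightarrow> zs \<and> L \<longlonglongrightarrow> l \<and> l \<in> mults \<and> (\<lambda>n. compl_gap (L n) (S n)) \<longlonglongrightarrow> 0"

text \<open>The solution set is closed and nonempty, so the distance is attained and a nearest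
  multiplier exists without any loss in \<open>e\<close>.\<close>

lemma sol_dist_le:
  assumes "sol_dist \<phi> g zs z lam \<le> e"
  obtains l where "l \<in> mults" "norm (z - zs) \<le> e" "norm (lam - l) \<le> e"
proof -
  have "closed ({zs} \<times> mults)"
    by (intro closed_Times closed_multipliers) auto
  moreover have "{zs} \<times> mults \<noteq> {}"
    using KKT_point by (auto simp: multipliers_def)
  ultimately obtain p where p: "p \<in> {zs} \<times> mults" "dist (z, lam) p \<le> e"
    using infdist_attains_inf assms unfolding sol_dist_def by metis
  then obtain l where l: "l \<in> mults" "norm (z - zs, lam - l) \<le> e"
    by (auto simp: dist_norm)
  then show ?thesis
    using that[of l] norm_fst_le[of "z - zs" "lam - l"] norm_snd_le[of "lam - l" "z - zs"] by linarith
qed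

text \<open>The common contradiction scheme: a bound that fails for every constant and in every
  neighbourhood fails along a sequence, and a bounded companion \<open>X\<close> may be taken to converge.\<close>

lemma near_bound:
  fixes X :: "'q \<Rightarrow> 'b :: euclidean_space" and a b :: "'q \<Rightarrow> real"
    and z :: "'q \<Rightarrow> real ^ 'n" and lam s :: "'q \<Rightarrow> real ^ 'm"
  assumes X: "\<And>q. P q \<Longrightarrow> norm (X q) \<le> M"
    and b: "\<And>q. P q \<Longrightarrow> b q \<ge> 0"
    and contra: "\<And>Q l x. \<lbrakk>\<And>n. P (Q n); central_seq (\<lambda>n. z (Q n)) (\<lambda>n. lam (Q n)) (\<lambda>n. s (Q n)) l;
      (\<lambda>n. X (Q n)) \<longlonglongrightarrow> x; \<And>n. a (Q n) > 0; (\<lambda>n. b (Q n) / a (Q n)) \<longlonglongrightarrow> 0\<rbrakk> \<Longrightarrow> False"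
  shows "\<exists>\<epsilon>>0. \<exists>K>0. \<forall>q. P q \<and> centrality \<phi> g C \<gamma> (z q) (lam q) (s q) \<and>
    sol_dist \<phi> g zs (z q) (lam q) \<le> \<epsilon> \<and> compl_gap (lam q) (s q) \<le> \<epsilon> \<longrightarrow> a q \<le> K * b q"
proof (rule ccontr)
  assume neg: "\<not> ?thesis"
  define W where "W = (\<lambda>\<epsilon> K. \<forall>q. P q \<and> centrality \<phi> g C \<gamma> (z q) (lam q) (s q) \<and>
    sol_dist \<phi> g zs (z q) (lam q) \<le> \<epsilon> \<and> compl_gap (lam q) (s q) \<le> \<epsilon> \<longrightarrow> a q \<le> K * b q)"
  have "\<not> (\<exists>\<epsilon>>0. \<exists>K>0. W \<epsilon> K)"
    using neg unfolding W_def .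
  moreover have "1 / real (Suc n) > 0" "real (Suc n) > 0" for n
    by simp_all
  ultimately have "\<not> W (1 / Suc n) (Suc n)" for n
    by blast
  then have "\<exists>q. P q \<and> centrality \<phi> g C \<gamma> (z q) (lam q) (s q) \<and>
    sol_dist \<phi> g zs (z q) (lam q) \<le> 1 / Suc n \<and> compl_gap (lam q) (s q) \<le> 1 / Suc n \<and>
    a q > Suc n * b q" for n
    unfolding W_def not_all not_imp not_le conj_assoc .
  then have "\<exists>Q. \<forall>n. P (Q n) \<and> centrality \<phi> g C \<gamma> (z (Q n)) (lam (Q n)) (s (Q n)) \<and>
    sol_dist \<phi> g zs (z (Q n)) (lam (Q n)) \<le> 1 / Suc n \<and> compl_gap (lam (Q n)) (s (Q n)) \<le> 1 / Suc n \<and>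
    a (Q n) > Suc n * b (Q n)"
    by (intro choice allI)
  then obtain Q where P: "\<And>n. P (Q n)"
    and cent: "\<And>n. centrality \<phi> g C \<gamma> (z (Q n)) (lam (Q n)) (s (Q n))"
    and dist: "\<And>n. sol_dist \<phi> g zs (z (Q n)) (lam (Q n)) \<le> 1 / Suc n"
    and gap: "\<And>n. compl_gap (lam (Q n)) (s (Q n)) \<le> 1 / Suc n"
    and ab: "\<And>n. a (Q n) > Suc n * b (Q n)"
    by blast
  have lim: "(\<lambda>n. 1 / real (Suc n)) \<longlonglongrightarrow> 0"
    using LIMSEQ_inverse_real_of_nat by (simp add: inverse_eq_divide)
  have "\<exists>l\<in>mults. norm (z (Q n) - zs) \<le> 1 / Suc n \<and> norm (lam (Q n) - l) \<le> 1 / Suc n" for n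
    using sol_dist_le[OF dist[of n]] by blast
  then obtain l where l: "\<And>n. l n \<in> mults" "\<And>n. norm (z (Q n) - zs) \<le> 1 / Suc n"
    "\<And>n. norm (lam (Q n) - l n) \<le> 1 / Suc n"
    by metis
  \<comment> \<open>The nearest multipliers range over a compact set, bounded by MFCQ. Pairing them
    with the companion \<open>X\<close> gives one subsequence along which both converge.\<close>
  have "compact (mults \<times> cball (0 :: 'b) M)"
    by (intro compact_Times compact_cball)
      (simp add: compact_eq_bounded_closed bounded_multipliers closed_multipliers MFCQ)
  moreover have "(l n, X (Q n)) \<in> mults \<times> cball 0 M" for n
    using l(1) X[OF P] by simp
  ultimately obtain p r where p: "p \<in> mults \<times> cball 0 M" and r: "strict_mono r"
    and pr: "((\<lambda>n. (l n, X (Q n))) \<circ> r) \<longlonglongrightarrow> p"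
    using seq_compactE[OF compact_imp_seq_compact, of "mults \<times> cball 0 M" "\<lambda>n. (l n, X (Q n))"] by blast
  note sub = LIMSEQ_subseq_LIMSEQ[OF _ r, unfolded o_def]
  have lr: "(\<lambda>n. l (r n)) \<longlonglongrightarrow> fst p" and Xr: "(\<lambda>n. X (Q (r n))) \<longlonglongrightarrow> snd p"
    using tendsto_fst[OF pr] tendsto_snd[OF pr] by (simp_all add: o_def)
  have "(\<lambda>n. z (Q n) - zs) \<longlonglongrightarrow> 0"
    by (rule Lim_null_comparison[OF always_eventually[OF allI] lim]) (rule l)
  from sub[OF this] have Zr: "(\<lambda>n. z (Q (r n))) \<longlonglongrightarrow> zs"
    by (simp add: LIM_zero_iff)
  have "(\<lambda>n. lam (Q n) - l n) \<longlonglongrightarrow> 0"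
    by (rule Lim_null_comparison[OF always_eventually[OF allI] lim]) (rule l)
  from tendsto_add[OF sub[OF this] lr] have Lr: "(\<lambda>n. lam (Q (r n))) \<longlonglongrightarrow> fst p"
    by simp
  have "(\<lambda>n. compl_gap (lam (Q n)) (s (Q n))) \<longlonglongrightarrow> 0"
  proof (rule Lim_null_comparison[OF always_eventually[OF allI] lim])
    show "norm (compl_gap (lam (Q n)) (s (Q n))) \<le> 1 / Suc n" for n
      using centralityD(8)[OF cent[of n]] gap[of n] by (simp only: real_norm_def abs_of_pos)
  qed
  note gr = sub[OF this]
  \<comment> \<open>As \<open>b\<close> is nonnegative, violating the bound with constant
    \<open>Suc n\<close> makes \<open>a\<close> positive and the quotient \<open>b / a\<close> at
    most \<open>1 / Suc n\<close>.\<close>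
  have a: "a (Q n) > 0" for n
    using ab[of n] b[OF P, of n] by (smt (verit) mult_nonneg_nonneg of_nat_0_le_iff)
  have "(\<lambda>n. b (Q n) / a (Q n)) \<longlonglongrightarrow> 0"
  proof (rule Lim_null_comparison[OF always_eventually[OF allI] lim])
    show "norm (b (Q n) / a (Q n)) \<le> 1 / real (Suc n)" for n
      using ab[of n] a[of n] b[OF P, of n] by (simp add: field_simps)
  qed
  note br = sub[OF this]
  show False
  proof (rule contra[of "\<lambda>n. Q (r n)"])
    show "central_seq (\<lambda>n. z (Q (r n))) (\<lambda>n. lam (Q (r n))) (\<lambda>n. s (Q (r n))) (fst p)"
      using cent Zr Lr gr p by (auto simp: central_seq_def)
  qed (use P Xr a br in auto)
qed

section \<open>The bound on the active slacks and the squared distance\<close>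

context
  fixes Z L S l
  assumes cs: "central_seq Z L S l"
begin

lemma central_seqD:
  shows "centrality \<phi> g C \<gamma> (Z n) (L n) (S n)" "Z \<longlonglongrightarrow> zs" "L \<longlonglongrightarrow> l" "l \<in> mults"
    "(\<lambda>n. compl_gap (L n) (S n)) \<longlonglongrightarrow> 0"
  using cs by (auto simp: central_seq_def)

lemma tendsto_slack: "(\<lambda>n. S n $ i) \<longlonglongrightarrow> - g zs $ i"
proof -
  have "(\<lambda>n. g (Z n) + S n) \<longlonglongrightarrow> 0"
    by (rule Lim_null_comparison[OF always_eventually[OF allI] tendsto_mult_right_zero[OF central_seqD(5)]])
      (rule centralityD(2)[OF central_seqD(1)])
  from tendsto_diff[OF tendsto_vec_nth[OF this, of i] tendsto_constraint[OF central_seqD(2), of i]]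
  show ?thesis by simp
qed

text \<open>The displacement is scaled by \<open>sqrt (\<rho> n)\<close> because
  \<open>\<rho>\<close> contains its square; the limit \<open>x\<close> has norm at most 1 and is
  critical. Dividing the expansion by \<open>\<rho> n\<close> bounds
  \<open>\<beta> * (1 - (norm x)\<^sup>2)\<close> by a negative quadratic form in \<open>x\<close>,
  which is impossible for \<open>x \<noteq> 0\<close> and reads \<open>\<beta> \<le> 0\<close> for
  \<open>x = 0\<close>.\<close>

lemma active_slack_bound_contra:
  defines "\<rho> \<equiv> \<lambda>n. (\<Sum>i\<in>act. S n $ i) + (norm (Z n - zs))\<^sup>2"
  assumes pos: "\<And>n. \<rho> n > 0" and small: "(\<lambda>n. compl_gap (L n) (S n) / \<rho> n) \<longlonglongrightarrow> 0"
    and x: "(\<lambda>n. (Z n - zs) /\<^sub>R sqrt (\<rho> n)) \<longlonglongrightarrow> x"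
  shows False
proof -
  note cent = centralityD[OF central_seqD(1)]
  note Z = central_seqD(2) and L = central_seqD(3)
  define \<mu> where "\<mu> = (\<lambda>n. compl_gap (L n) (S n))"
  define \<tau> where "\<tau> = (\<lambda>n. sqrt (\<rho> n))"
  define X where "X = (\<lambda>n. (Z n - zs) /\<^sub>R \<tau> n)"
  define r1 where "r1 = (\<lambda>n. lagr_z \<phi> g (Z n) (L n))"
  define r2 where "r2 = (\<lambda>n. g (Z n) + S n)"
  define H where "H = lagr_zz \<phi> g zs"
  obtain lb \<beta> where lb: "lb \<in> mults" "\<beta> > 0" "\<And>i. i \<in> act \<Longrightarrow> lb $ i \<ge> \<beta>"
    by (rule strict_multiplier) blast
  have small: "(\<lambda>n. \<mu> n / \<rho> n) \<longlonglongrightarrow> 0" and X: "X \<longlonglongrightarrow> x"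
    using small x by (simp_all add: \<mu>_def X_def \<tau>_def)
  have \<tau>: "\<tau> n > 0" "\<tau> n * \<tau> n = \<rho> n" "Z n - zs = \<tau> n *\<^sub>R X n" for n
    using pos[of n] by (simp_all add: \<tau>_def X_def)
  have slack_le: "(\<Sum>i\<in>act. S n $ i) \<le> \<rho> n" "S n $ i \<le> \<rho> n" if "i \<in> act" for n i
  proof -
    show le: "(\<Sum>i\<in>act. S n $ i) \<le> \<rho> n" by (simp add: \<rho>_def)
    have "S n $ i \<le> (\<Sum>i\<in>act. S n $ i)"
      using that cent(4) by (intro member_le_sum) (auto simp: less_imp_le)
    with le show "S n $ i \<le> \<rho> n" by simp
  qed
  have sq_le: "(norm (Z n - zs))\<^sup>2 \<le> \<rho> n" for n
    using cent(4) by (simp add: \<rho>_def sum_nonneg less_imp_le)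
  then have le: "norm (Z n - zs) \<le> \<tau> n" for n
    by (simp add: \<tau>_def real_le_rsqrt)
  have "\<rho> \<longlonglongrightarrow> (\<Sum>i\<in>act. - g zs $ i) + (norm (zs - zs))\<^sup>2"
    unfolding \<rho>_def by (intro tendsto_intros tendsto_slack Z)
  then have "\<rho> \<longlonglongrightarrow> 0" by (simp add: active_def)
  from tendsto_real_sqrt[OF this] have \<tau>0: "\<tau> \<longlonglongrightarrow> 0" by (simp add: \<tau>_def)
  have small': "(\<lambda>n. \<mu> n / \<tau> n) \<longlonglongrightarrow> 0"
  proof -
    have "(\<lambda>n. \<mu> n / \<rho> n * \<tau> n) \<longlonglongrightarrow> 0 * 0" by (intro tendsto_mult small \<tau>0)
    moreover have "\<mu> n / \<rho> n * \<tau> n = \<mu> n / \<tau> n" for n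
      using \<tau>(1)[of n] by (simp flip: \<tau>(2))
    ultimately show ?thesis by simp
  qed
  have r1\<tau>: "(\<lambda>n. r1 n /\<^sub>R \<tau> n) \<longlonglongrightarrow> 0" and r2\<tau>: "(\<lambda>n. r2 n /\<^sub>R \<tau> n) \<longlonglongrightarrow> 0"
    and r2\<rho>: "(\<lambda>n. r2 n /\<^sub>R \<rho> n) \<longlonglongrightarrow> 0"
    using cent(1,2) \<tau>(1) pos small small'
    by (auto intro!: tendsto_scaled_residual[where \<mu> = \<mu> and c = C] simp: \<mu>_def r1_def r2_def)
  \<comment> \<open>An active slack is at most \<open>\<rho> n = \<tau> n * \<tau> n\<close>, so it
    still vanishes after division by \<open>\<tau> n\<close>, and the linearized active constraints
    vanish on \<open>x\<close>.\<close>
  have crit: "dg i zs \<bullet> x = 0" if i: "i \<in> act" for i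
  proof -
    define e where "e = (\<lambda>n. (g (Z n) $ i - g zs $ i - dg i zs \<bullet> (Z n - zs)) / \<tau> n)"
    have e: "e \<longlonglongrightarrow> 0"
      unfolding e_def by (rule tendsto_constraint_remainder[OF Z le])
    have "(\<lambda>n. S n $ i / \<tau> n) \<longlonglongrightarrow> 0"
    proof (rule Lim_null_comparison[OF always_eventually[OF allI] \<tau>0])
      show "norm (S n $ i / \<tau> n) \<le> \<tau> n" for n
        using slack_le(2)[OF i, of n] \<tau>[of n] cent(4)[of n i] by (simp add: pos_divide_le_eq)
    qed
    from tendsto_diff[OF tendsto_diff[OF tendsto_vec_nth[OF r2\<tau>, of i] this] e]
    have "(\<lambda>n. (r2 n /\<^sub>R \<tau> n) $ i - S n $ i / \<tau> n - e n) \<longlonglongrightarrow> 0" by simp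
    moreover have "(r2 n /\<^sub>R \<tau> n) $ i - S n $ i / \<tau> n - e n = dg i zs \<bullet> X n" for n
    proof -
      have "dg i zs \<bullet> (Z n - zs) = \<tau> n * (dg i zs \<bullet> X n)" by (simp add: \<tau>(3))
      then show ?thesis
        using i \<tau>(1)[of n] by (simp add: e_def r2_def active_def field_simps)
    qed
    ultimately have "(\<lambda>n. dg i zs \<bullet> X n) \<longlonglongrightarrow> 0" by simp
    moreover have "(\<lambda>n. dg i zs \<bullet> X n) \<longlonglongrightarrow> dg i zs \<bullet> x" by (intro tendsto_intros X)
    ultimately show ?thesis using LIMSEQ_unique by blast
  qed
  define E1 where "E1 = (\<lambda>n. (lagrangian \<phi> g (Z n) (L n) - lagrangian \<phi> g zs (L n)
    - lagr_z \<phi> g zs (L n) \<bullet> (Z n - zs) - (Z n - zs) \<bullet> (H (L n) *v (Z n - zs)) / 2) / \<rho> n)"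
  define E2 where "E2 = (\<lambda>n. (lagrangian \<phi> g (Z n) lb - lagrangian \<phi> g zs lb
    - lagr_z \<phi> g zs lb \<bullet> (Z n - zs) - (Z n - zs) \<bullet> (H lb *v (Z n - zs)) / 2) / \<rho> n)"
  define E3 where "E3 = (\<lambda>n. (lagr_z \<phi> g (Z n) (L n) - lagr_z \<phi> g zs (L n)
    - H (L n) *v (Z n - zs)) /\<^sub>R \<tau> n)"
  have E: "E1 \<longlonglongrightarrow> 0" "E2 \<longlonglongrightarrow> 0" "E3 \<longlonglongrightarrow> 0"
    unfolding E1_def E2_def E3_def H_def
    by (rule tendsto_lagrangian_remainder[OF Z L sq_le] tendsto_lagrangian_remainder[OF Z tendsto_const sq_le]
      tendsto_lagr_z_remainder[OF Z L le])+
  define rhs where "rhs = (\<lambda>n. real CARD('m) * (\<mu> n / \<rho> n) - (L n - lb) \<bullet> (r2 n /\<^sub>R \<rho> n) + E1 n - E2 n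
    + (r1 n /\<^sub>R \<tau> n) \<bullet> X n - X n \<bullet> (H (L n) *v X n) / 2 - E3 n \<bullet> X n - X n \<bullet> (H lb *v X n) / 2)"
  have ineq: "\<beta> * (1 - (norm (X n))\<^sup>2) \<le> rhs n" for n
  proof -
    define d where "d = Z n - zs"
    have d: "d = \<tau> n *\<^sub>R X n" by (simp add: d_def \<tau>)
    have gz: "L n \<bullet> g zs \<le> 0"
      unfolding inner_vec_def inner_real_def
      using cent(3) feasible by (intro sum_nonpos mult_nonneg_nonpos) (auto simp: less_imp_le)
    have "\<beta> * (\<Sum>i\<in>act. S n $ i) \<le> (\<Sum>i\<in>act. lb $ i * S n $ i)"
      unfolding sum_distrib_left using lb(3) cent(4) by (intro sum_mono mult_right_mono) (auto simp: less_imp_le)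
    also have "\<dots> \<le> lb \<bullet> S n"
      unfolding inner_vec_def inner_real_def using multsD(2)[OF lb(1)] cent(4)
      by (intro sum_mono2) (auto simp: less_imp_le)
    \<comment> \<open>Here \<open>lb \<bullet> g zs = 0\<close> by complementarity, while
      \<open>L n \<bullet> g zs \<le> 0\<close> by positivity of \<open>L n\<close> and feasibility
      of \<open>zs\<close>.\<close>
    also have "\<dots> \<le> L n \<bullet> S n - (L n - lb) \<bullet> (S n + g zs)"
      using gz multsD(3)[OF lb(1)] by (simp add: inner_diff_left inner_add_right)
    \<comment> \<open>Substituting \<open>S n = r2 n - g (Z n)\<close> leaves
      \<open>L n - lb\<close> paired with the increment of \<open>g\<close>. This is a difference of
      two Lagrangian increments, in which the contributions of \<open>\<phi>\<close> cancel.\<close>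
    also have "\<dots> = real CARD('m) * \<mu> n - (L n - lb) \<bullet> r2 n
      + (lagrangian \<phi> g (Z n) (L n) - lagrangian \<phi> g zs (L n))
      - (lagrangian \<phi> g (Z n) lb - lagrangian \<phi> g zs lb)"
      by (simp add: cent(7)[of n] \<mu>_def r2_def lagrangian_def inner_diff_left inner_add_right)
    also have "lagrangian \<phi> g (Z n) (L n) - lagrangian \<phi> g zs (L n) =
      \<rho> n * E1 n + lagr_z \<phi> g zs (L n) \<bullet> d + d \<bullet> (H (L n) *v d) / 2"
      using pos[of n] by (simp add: E1_def d_def)
    also have "lagrangian \<phi> g (Z n) lb - lagrangian \<phi> g zs lb = \<rho> n * E2 n + d \<bullet> (H lb *v d) / 2"
      using pos[of n] lb(1) by (simp add: E2_def d_def multipliers_def KKT_def)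
    \<comment> \<open>Centrality controls the gradient at \<open>Z n\<close>, not at
      \<open>zs\<close>. The exchange costs \<open>H (L n) *v d\<close>, which turns the quadratic
      term for \<open>L n\<close> from plus one half into minus one half; both Hessians then have
      the favourable sign.\<close>
    also have "lagr_z \<phi> g zs (L n) = r1 n - H (L n) *v d - \<tau> n *\<^sub>R E3 n"
      using \<tau>(1)[of n] by (simp add: E3_def d_def r1_def)
    finally have "\<beta> * (\<Sum>i\<in>act. S n $ i) \<le> real CARD('m) * \<mu> n - (L n - lb) \<bullet> r2 n
      + (\<rho> n * E1 n + (r1 n - H (L n) *v d - \<tau> n *\<^sub>R E3 n) \<bullet> d + d \<bullet> (H (L n) *v d) / 2)
      - (\<rho> n * E2 n + d \<bullet> (H lb *v d) / 2)" .
    also have "\<dots> = \<rho> n * rhs n"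
    proof -
      have "\<rho> n * (real CARD('m) * (\<mu> n / \<rho> n)) = real CARD('m) * \<mu> n"
        "\<rho> n * ((L n - lb) \<bullet> (r2 n /\<^sub>R \<rho> n)) = (L n - lb) \<bullet> r2 n"
        using pos[of n] by simp_all
      moreover have "\<rho> n * ((r1 n /\<^sub>R \<tau> n) \<bullet> X n) = r1 n \<bullet> d"
        "\<rho> n * (X n \<bullet> (H (L n) *v X n) / 2) = d \<bullet> (H (L n) *v d) / 2"
        "\<rho> n * (X n \<bullet> (H lb *v X n) / 2) = d \<bullet> (H lb *v d) / 2"
        "\<rho> n * (E3 n \<bullet> X n) = (\<tau> n *\<^sub>R E3 n) \<bullet> d"
        using \<tau>(1)[of n] by (simp_all add: d matrix_vector_mult_scaleR flip: \<tau>(2))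
      ultimately show ?thesis
        unfolding rhs_def inner_diff_left[of "r1 n - _"] inner_diff_left[of "r1 n"]
          inner_commute[of "H (L n) *v d"] right_diff_distrib[of "\<rho> n"] distrib_left[of "\<rho> n"]
        by linarith
    qed
    finally have "\<beta> * (\<Sum>i\<in>act. S n $ i) \<le> \<rho> n * rhs n" .
    moreover have "(\<Sum>i\<in>act. S n $ i) = \<rho> n * (1 - (norm (X n))\<^sup>2)"
    proof -
      have "(norm d)\<^sup>2 = \<rho> n * (norm (X n))\<^sup>2"
        using \<tau>(1)[of n] by (simp add: d power_mult_distrib power2_eq_square flip: \<tau>(2))
      moreover have "\<rho> n = (\<Sum>i\<in>act. S n $ i) + (norm d)\<^sup>2"
        by (simp add: \<rho>_def d_def)
      ultimately show ?thesis by (simp add: algebra_simps)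
    qed
    ultimately have "\<rho> n * (\<beta> * (1 - (norm (X n))\<^sup>2)) \<le> \<rho> n * rhs n"
      by (simp add: mult.left_commute)
    then show ?thesis using pos[of n] by simp
  qed
  have "rhs \<longlonglongrightarrow> real CARD('m) * 0 - (l - lb) \<bullet> 0 + 0 - 0 + 0 \<bullet> x - x \<bullet> (H l *v x) / 2 - 0 \<bullet> x - x \<bullet> (H lb *v x) / 2"
    unfolding rhs_def H_def
    by (intro tendsto_intros small L r2\<rho> E r1\<tau> X tendsto_lagr_zz[OF tendsto_const L]) simp_all
  moreover have "(\<lambda>n. \<beta> * (1 - (norm (X n))\<^sup>2)) \<longlonglongrightarrow> \<beta> * (1 - (norm x)\<^sup>2)"
    by (intro tendsto_intros X)
  ultimately have lim: "\<beta> * (1 - (norm x)\<^sup>2) \<le> - x \<bullet> (H l *v x) / 2 - x \<bullet> (H lb *v x) / 2"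
    using ineq by (auto intro: LIMSEQ_le)
  have "norm (X n) \<le> 1" for n
    using le[of n] \<tau>(1)[of n] by (simp add: X_def divide_inverse_commute[symmetric])
  then have "norm x \<le> 1"
    using X by (auto intro: LIMSEQ_le_const2 tendsto_norm)
  then have "\<beta> * (1 - (norm x)\<^sup>2) \<ge> 0"
    using lb(2) by (simp add: power_le_one)
  then have "x = 0"
    using lim second_order_critical[OF central_seqD(4) crit] second_order_critical[OF lb(1) crit]
    unfolding H_def by fastforce
  then show False
    using lim lb(2) by simp
qed

end

lemma active_slack_bound:
  "\<exists>\<epsilon>>0. \<exists>K>0. \<forall>z lam s. centrality \<phi> g C \<gamma> z lam s \<and>
    sol_dist \<phi> g zs z lam \<le> \<epsilon> \<and> compl_gap lam s \<le> \<epsilon> \<longrightarrow>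
    (\<Sum>i\<in>act. s $ i) + (norm (z - zs))\<^sup>2 \<le> K * compl_gap lam s"
proof -
  define a where "a = (\<lambda>(z :: real ^ 'n, lam :: real ^ 'm, s :: real ^ 'm). (\<Sum>i\<in>act. s $ i) + (norm (z - zs))\<^sup>2)"
  \<comment> \<open>Centrality appears twice because the bounds on \<open>X\<close> and
    \<open>b\<close> in \<open>near_bound\<close> may draw only on the predicate
    \<open>P\<close>.\<close>
  have "\<exists>\<epsilon>>0. \<exists>K>0. \<forall>q. (case q of (z, lam, s) \<Rightarrow> centrality \<phi> g C \<gamma> z lam s) \<and>
    centrality \<phi> g C \<gamma> (fst q) (fst (snd q)) (snd (snd q)) \<and>
    sol_dist \<phi> g zs (fst q) (fst (snd q)) \<le> \<epsilon> \<and> compl_gap (fst (snd q)) (snd (snd q)) \<le> \<epsilon>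
    \<longrightarrow> a q \<le> K * compl_gap (fst (snd q)) (snd (snd q))"
  proof (rule near_bound[where X = "\<lambda>q. (fst q - zs) /\<^sub>R sqrt (a q)" and M = 1])
    fix q :: "(real ^ 'n) \<times> (real ^ 'm) \<times> (real ^ 'm)"
    assume "case q of (z, lam, s) \<Rightarrow> centrality \<phi> g C \<gamma> z lam s"
    then have cent: "centrality \<phi> g C \<gamma> (fst q) (fst (snd q)) (snd (snd q))"
      by (auto split: prod.splits)
    then show "compl_gap (fst (snd q)) (snd (snd q)) \<ge> 0"
      using centralityD(8) by (simp add: less_imp_le)
    have "(norm (fst q - zs))\<^sup>2 \<le> a q"
      using centralityD(4)[OF cent] by (auto simp: a_def sum_nonneg less_imp_le split: prod.splits)
    then have "norm (fst q - zs) \<le> sqrt (a q)"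
      by (simp add: real_le_rsqrt)
    then show "norm ((fst q - zs) /\<^sub>R sqrt (a q)) \<le> 1"
      using order_trans[OF norm_ge_zero, of "fst q - zs" "sqrt (a q)"]
      by (auto simp: divide_inverse_commute[symmetric] divide_le_eq_1)
  next
    fix Q l x
    assume "central_seq (\<lambda>n. fst (Q n)) (\<lambda>n. fst (snd (Q n))) (\<lambda>n. snd (snd (Q n))) l"
      "(\<lambda>n. (fst (Q n) - zs) /\<^sub>R sqrt (a (Q n))) \<longlonglongrightarrow> x" "\<And>n. a (Q n) > 0"
      "(\<lambda>n. compl_gap (fst (snd (Q n))) (snd (snd (Q n))) / a (Q n)) \<longlonglongrightarrow> 0"
    then show False
      using active_slack_bound_contra[of "\<lambda>n. fst (Q n)" "\<lambda>n. fst (snd (Q n))" "\<lambda>n. snd (snd (Q n))" l x]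
      by (simp add: a_def case_prod_beta)
  qed
  then show ?thesis by (simp add: a_def)
qed

text \<open>The directions in which the multipliers at \<open>zs\<close> are not determined.\<close>

definition dual_kernel :: "(real ^ 'm) set"
  where "dual_kernel = {v. grads g zs *v v = 0 \<and> (\<forall>i. i \<notin> act \<longrightarrow> v $ i = 0)}"

section \<open>The primal error bound, modulo the undetermined multiplier directions\<close>

lemma subspace_dual_kernel: "subspace dual_kernel"
  by (auto simp: subspace_def dual_kernel_def matrix_vector_right_distrib matrix_vector_mult_scaleR)

text \<open>\<open>U\<close> is the orthogonal projection onto the complement of
  \<open>dual_kernel\<close>.\<close>

lemma dual_kernel_projection:
  obtains U where "\<And>v. v - U v \<in> dual_kernel" "\<And>v w. w \<in> dual_kernel \<Longrightarrow> U v \<bullet> w = 0"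
proof -
  have "\<exists>u. v - u \<in> dual_kernel \<and> (\<forall>w\<in>dual_kernel. u \<bullet> w = 0)" for v
  proof -
    obtain y z where "y \<in> span dual_kernel" "\<And>w. w \<in> span dual_kernel \<Longrightarrow> orthogonal z w" "v = y + z"
      by (rule orthogonal_subspace_decomp_exists[of dual_kernel v]) blast
    moreover have "span dual_kernel = dual_kernel"
      using subspace_dual_kernel by (simp add: span_eq_iff)
    ultimately show ?thesis
      by (intro exI[of _ z]) (auto simp: orthogonal_def)
  qed
  then show ?thesis using that by metis
qed

text \<open>The product \<open>L n $ i * S n $ i\<close> is at most \<open>CARD('m)\<close> times
  the gap, and an inactive slack tends to the positive number \<open>- g zs $ i\<close>.\<close>

lemma tendsto_inactive_multiplier:
  assumes cs: "central_seq Z L S l" and i: "i \<notin> act" and pos: "\<And>n. \<tau> n > 0"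
    and small: "(\<lambda>n. compl_gap (L n) (S n) / \<tau> n) \<longlonglongrightarrow> 0"
  shows "(\<lambda>n. L n $ i / \<tau> n) \<longlonglongrightarrow> 0"
proof (rule Lim_null_comparison[OF always_eventually[OF allI]])
  note cent = centralityD[OF central_seqD(1)[OF cs]]
  show "norm (L n $ i / \<tau> n) \<le> real CARD('m) * (compl_gap (L n) (S n) / \<tau> n) / S n $ i" for n
  proof -
    have "L n $ i \<le> real CARD('m) * compl_gap (L n) (S n) / S n $ i"
      using cent(6)[of n i] cent(7)[of n] cent(4)[of n i] by (simp add: pos_le_divide_eq)
    then have "L n $ i / \<tau> n \<le> real CARD('m) * compl_gap (L n) (S n) / S n $ i / \<tau> n"
      using pos[of n] by (intro divide_right_mono) simp_all
    then show ?thesis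
      using cent(3)[of n i] pos[of n] by (simp add: mult.commute)
  qed
  have "(\<lambda>n. real CARD('m) * (compl_gap (L n) (S n) / \<tau> n) / S n $ i)
    \<longlonglongrightarrow> real CARD('m) * 0 / (- g zs $ i)"
    using i by (intro tendsto_intros small tendsto_slack[OF cs]) (simp add: active_def)
  then show "(\<lambda>n. real CARD('m) * (compl_gap (L n) (S n) / \<tau> n) / S n $ i) \<longlonglongrightarrow> 0"
    by simp
qed

text \<open>\<open>L n - lb\<close> need not be small along \<open>dual_kernel\<close>, so only its
  component \<open>u n\<close> orthogonal to that space is measured together with
  \<open>Z n - zs\<close>. In the limit the dual part lies in \<open>dual_kernel\<close> and is
  orthogonal to it, hence is 0, against the unit normalization.\<close>

lemma primal_error_bound_contra:
  assumes cs: "central_seq Z L S l" and lb: "lb \<in> mults"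
    and slack: "\<And>n i. i \<in> act \<Longrightarrow> S n $ i \<le> K * compl_gap (L n) (S n)"
    and u: "\<And>n. L n - lb - u n \<in> dual_kernel" "\<And>n v. v \<in> dual_kernel \<Longrightarrow> u n \<bullet> v = 0"
    and pos: "\<And>n. norm (Z n - zs, u n) > 0"
    and small: "(\<lambda>n. compl_gap (L n) (S n) / norm (Z n - zs, u n)) \<longlonglongrightarrow> 0"
    and lim: "(\<lambda>n. (Z n - zs, u n) /\<^sub>R norm (Z n - zs, u n)) \<longlonglongrightarrow> xy"
  shows False
proof -
  note cent = centralityD[OF central_seqD(1)[OF cs]]
  note Z = central_seqD(2)[OF cs] and L = central_seqD(3)[OF cs]
  define \<mu> where "\<mu> = (\<lambda>n. compl_gap (L n) (S n))"
  define \<tau> where "\<tau> = (\<lambda>n. norm (Z n - zs, u n))"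
  define X where "X = (\<lambda>n. (Z n - zs) /\<^sub>R \<tau> n)"
  define Y where "Y = (\<lambda>n. u n /\<^sub>R \<tau> n)"
  define H where "H = lagr_zz \<phi> g zs"
  obtain x y where xy: "xy = (x, y)" by (cases xy)
  have \<tau>: "\<tau> n > 0" for n using pos by (simp add: \<tau>_def)
  have small: "(\<lambda>n. \<mu> n / \<tau> n) \<longlonglongrightarrow> 0"
    using small by (simp add: \<mu>_def \<tau>_def)
  have X: "X \<longlonglongrightarrow> x" and Y: "Y \<longlonglongrightarrow> y"
    using tendsto_fst[OF lim] tendsto_snd[OF lim] by (simp_all add: xy X_def Y_def \<tau>_def)
  have le: "norm (Z n - zs) \<le> \<tau> n" for n
    unfolding \<tau>_def by (rule norm_fst_le)
  have r: "(\<lambda>n. lagr_z \<phi> g (Z n) (L n) /\<^sub>R \<tau> n) \<longlonglongrightarrow> 0" "(\<lambda>n. (g (Z n) + S n) /\<^sub>R \<tau> n) \<longlonglongrightarrow> 0"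
    by (rule tendsto_scaled_residual[OF _ \<tau> small], unfold \<mu>_def, rule cent(1))
      (rule tendsto_scaled_residual[OF _ \<tau> small], unfold \<mu>_def, rule cent(2))
  have crit: "dg i zs \<bullet> x = 0" if i: "i \<in> act" for i
  proof -
    define e where "e = (\<lambda>n. (g (Z n) $ i - g zs $ i - dg i zs \<bullet> (Z n - zs)) / \<tau> n)"
    have e: "e \<longlonglongrightarrow> 0"
      unfolding e_def by (rule tendsto_constraint_remainder[OF Z le])
    have "(\<lambda>n. S n $ i /\<^sub>R \<tau> n) \<longlonglongrightarrow> 0"
      by (rule tendsto_scaled_residual[OF _ \<tau> small, of _ K])
        (use slack[OF i] cent(4) in \<open>simp add: \<mu>_def less_imp_le\<close>)
    from tendsto_diff[OF tendsto_diff[OF tendsto_vec_nth[OF r(2), of i] this] e]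
    have "(\<lambda>n. ((g (Z n) + S n) /\<^sub>R \<tau> n) $ i - S n $ i /\<^sub>R \<tau> n - e n) \<longlonglongrightarrow> 0" by simp
    moreover have "((g (Z n) + S n) /\<^sub>R \<tau> n) $ i - S n $ i /\<^sub>R \<tau> n - e n = dg i zs \<bullet> X n" for n
    proof -
      have "dg i zs \<bullet> (Z n - zs) = \<tau> n * (dg i zs \<bullet> X n)"
        using \<tau>[of n] by (simp add: X_def)
      then show ?thesis
        using i \<tau>[of n] by (simp add: e_def active_def field_simps)
    qed
    ultimately have "(\<lambda>n. dg i zs \<bullet> X n) \<longlonglongrightarrow> 0" by simp
    moreover have "(\<lambda>n. dg i zs \<bullet> X n) \<longlonglongrightarrow> dg i zs \<bullet> x" by (intro tendsto_intros X)
    ultimately show ?thesis using LIMSEQ_unique by blast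
  qed
  have inactive: "y $ i = 0" if i: "i \<notin> act" for i
  proof -
    \<comment> \<open>Outside the active set both \<open>lb\<close> and the elements of
      \<open>dual_kernel\<close> vanish.\<close>
    have "u n $ i = L n $ i" for n
    proof -
      have "(L n - lb - u n) $ i = 0"
        using u(1)[of n] i unfolding dual_kernel_def by blast
      then show ?thesis using KKT_complementary[OF lb i] by simp
    qed
    then have "(\<lambda>n. Y n $ i) \<longlonglongrightarrow> 0"
      using tendsto_inactive_multiplier[OF cs i \<tau> small[unfolded \<mu>_def]]
      by (simp add: Y_def divide_inverse_commute)
    then show ?thesis using tendsto_vec_nth[OF Y, of i] LIMSEQ_unique by blast
  qed
  have eq: "H l *v x + grads g zs *v y = 0"
  proof -
    define e where "e = (\<lambda>n. (lagr_z \<phi> g (Z n) (L n) - lagr_z \<phi> g zs (L n) - H (L n) *v (Z n - zs)) /\<^sub>R \<tau> n)"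
    have e: "e \<longlonglongrightarrow> 0"
      unfolding e_def H_def by (rule tendsto_lagr_z_remainder[OF Z L le])
    \<comment> \<open>\<open>lb\<close> is stationary at \<open>zs\<close> and
      \<open>grads g zs\<close> annihilates \<open>dual_kernel\<close>, so of the multiplier only
      \<open>u n\<close> survives.\<close>
    have "lagr_z \<phi> g zs (L n) = grads g zs *v u n" for n
      using u(1)[of n] multsD(1)[OF lb]
      by (simp add: lagr_z_eq dual_kernel_def matrix_vector_mult_diff_distrib algebra_simps add_eq_0_iff)
    then have "lagr_z \<phi> g (Z n) (L n) /\<^sub>R \<tau> n - e n = H (L n) *v X n + grads g zs *v Y n" for n
      by (simp add: e_def X_def Y_def matrix_vector_mult_scaleR algebra_simps)
    with tendsto_diff[OF r(1) e] have "(\<lambda>n. H (L n) *v X n + grads g zs *v Y n) \<longlonglongrightarrow> 0" by simp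
    moreover have "(\<lambda>n. H (L n) *v X n + grads g zs *v Y n) \<longlonglongrightarrow> H l *v x + grads g zs *v y"
      unfolding H_def by (intro tendsto_intros tendsto_lagr_zz[OF tendsto_const L] X Y)
    ultimately show ?thesis using LIMSEQ_unique by blast
  qed
  have "x = 0"
    using second_order_kernel[OF central_seqD(4)[OF cs] crit inactive] eq by (simp add: H_def)
  then have "y \<in> dual_kernel"
    using eq inactive by (simp add: dual_kernel_def)
  \<comment> \<open>Every \<open>Y n\<close> is orthogonal to \<open>dual_kernel\<close>, in
    particular to the limit \<open>y\<close>.\<close>
  then have "(\<lambda>n. Y n \<bullet> y) \<longlonglongrightarrow> 0"
    using u(2) by (simp add: Y_def)
  moreover have "(\<lambda>n. Y n \<bullet> y) \<longlonglongrightarrow> y \<bullet> y" by (intro tendsto_intros Y)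
  ultimately have "y = 0"
    using LIMSEQ_unique by fastforce
  have "norm ((Z n - zs, u n) /\<^sub>R norm (Z n - zs, u n)) = 1" for n
    using pos[of n] by (simp del: scaleR_Pair)
  with tendsto_norm[OF lim] have "norm xy = 1"
    by (simp only: LIMSEQ_const_iff)
  with \<open>x = 0\<close> \<open>y = 0\<close> xy show False by (simp add: zero_prod_def[symmetric])
qed

lemma primal_error_bound:
  "\<exists>\<epsilon>>0. \<exists>K>0. \<forall>z lam s. centrality \<phi> g C \<gamma> z lam s \<and> (\<forall>i\<in>act. s $ i \<le> K' * compl_gap lam s) \<and>
    sol_dist \<phi> g zs z lam \<le> \<epsilon> \<and> compl_gap lam s \<le> \<epsilon> \<longrightarrow> norm (z - zs) \<le> K * compl_gap lam s"
proof -
  obtain lb where lb: "lb \<in> mults"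
    using strict_multiplier by blast
  obtain U where U: "\<And>v. v - U v \<in> dual_kernel" "\<And>v w. w \<in> dual_kernel \<Longrightarrow> U v \<bullet> w = 0"
    by (rule dual_kernel_projection) blast
  define z where "z = (\<lambda>q :: (real ^ 'n) \<times> (real ^ 'm) \<times> (real ^ 'm). fst q)"
  define lam where "lam = (\<lambda>q :: (real ^ 'n) \<times> (real ^ 'm) \<times> (real ^ 'm). fst (snd q))"
  define s where "s = (\<lambda>q :: (real ^ 'n) \<times> (real ^ 'm) \<times> (real ^ 'm). snd (snd q))"
  \<comment> \<open>The bound is proved for the whole pair; the primal error is then read off as its
    first component.\<close>
  define D where "D = (\<lambda>q. (z q - zs, U (lam q - lb)))"
  have "\<exists>\<epsilon>>0. \<exists>K>0. \<forall>q. (centrality \<phi> g C \<gamma> (z q) (lam q) (s q) \<and>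
    (\<forall>i\<in>act. s q $ i \<le> K' * compl_gap (lam q) (s q))) \<and> centrality \<phi> g C \<gamma> (z q) (lam q) (s q) \<and>
    sol_dist \<phi> g zs (z q) (lam q) \<le> \<epsilon> \<and> compl_gap (lam q) (s q) \<le> \<epsilon> \<longrightarrow>
    norm (D q) \<le> K * compl_gap (lam q) (s q)"
  proof (rule near_bound[where X = "\<lambda>q. D q /\<^sub>R norm (D q)" and M = 1])
    fix q assume "centrality \<phi> g C \<gamma> (z q) (lam q) (s q) \<and> (\<forall>i\<in>act. s q $ i \<le> K' * compl_gap (lam q) (s q))"
    then show "compl_gap (lam q) (s q) \<ge> 0"
      using centralityD(8) less_imp_le by blast
    show "norm (D q /\<^sub>R norm (D q)) \<le> 1" by (cases "D q = 0") simp_all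
  next
    fix Q l x
    assume "\<And>n. centrality \<phi> g C \<gamma> (z (Q n)) (lam (Q n)) (s (Q n)) \<and>
        (\<forall>i\<in>act. s (Q n) $ i \<le> K' * compl_gap (lam (Q n)) (s (Q n)))"
      "central_seq (\<lambda>n. z (Q n)) (\<lambda>n. lam (Q n)) (\<lambda>n. s (Q n)) l"
      "(\<lambda>n. D (Q n) /\<^sub>R norm (D (Q n))) \<longlonglongrightarrow> x" "\<And>n. norm (D (Q n)) > 0"
      "(\<lambda>n. compl_gap (lam (Q n)) (s (Q n)) / norm (D (Q n))) \<longlonglongrightarrow> 0"
    then show False
      using U lb unfolding D_def
      by (intro primal_error_bound_contra[of "\<lambda>n. z (Q n)" "\<lambda>n. lam (Q n)" "\<lambda>n. s (Q n)" l lb K'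
            "\<lambda>n. U (lam (Q n) - lb)" x]) blast+
  qed
  then obtain \<epsilon> K where \<epsilon>: "\<epsilon> > 0" "K > 0" and K: "\<And>q. centrality \<phi> g C \<gamma> (z q) (lam q) (s q) \<Longrightarrow>
    (\<forall>i\<in>act. s q $ i \<le> K' * compl_gap (lam q) (s q)) \<Longrightarrow>
    sol_dist \<phi> g zs (z q) (lam q) \<le> \<epsilon> \<Longrightarrow> compl_gap (lam q) (s q) \<le> \<epsilon> \<Longrightarrow>
    norm (D q) \<le> K * compl_gap (lam q) (s q)"
    by blast
  have "norm (z' - zs) \<le> K * compl_gap lam' s'"
    if "centrality \<phi> g C \<gamma> z' lam' s'" "\<forall>i\<in>act. s' $ i \<le> K' * compl_gap lam' s'"
      "sol_dist \<phi> g zs z' lam' \<le> \<epsilon>" "compl_gap lam' s' \<le> \<epsilon>" for z' lam' s'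
    using K[of "(z', lam', s')"] that norm_fst_le[of "z' - zs" "U (lam' - lb)"]
    by (simp add: D_def z_def lam_def s_def)
  with \<epsilon> show ?thesis by blast
qed

section \<open>The step equations\<close>

text \<open>The step equations with the right-hand side scaled by \<open>\<theta>\<close>. The value \<open>\<theta> = 0\<close> is the
  homogeneous system, so a lower bound on \<open>\<theta>\<close> for unit solutions gives both solvability and the bound
  on the step.\<close>

definition scaled_step ::
  "real \<Rightarrow> real ^ 'n \<Rightarrow> real ^ 'm \<Rightarrow> real ^ 'm \<Rightarrow> real ^ 'm \<Rightarrow> real ^ 'n \<Rightarrow> real ^ 'm \<Rightarrow> real ^ 'm \<Rightarrow> bool"
  where "scaled_step \<theta> z lam s t x y w \<longleftrightarrow>
    lagr_zz \<phi> g z lam *v x + grads g z *v y = - \<theta> *\<^sub>R lagr_z \<phi> g z lam \<and>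
    (\<forall>i. dg i z \<bullet> x + w $ i = - \<theta> * (g z + s) $ i) \<and>
    (\<forall>i. s $ i * y $ i + lam $ i * w $ i = - \<theta> * (s $ i * lam $ i + t $ i))"

text \<open>The limit of the three rows determines \<open>x\<close>, \<open>w\<close> and the
  inactive part of \<open>y\<close>, but leaves \<open>y\<close> free in \<open>dual_kernel\<close>.
  The active part of \<open>y\<close> is decided one order later, and there the rates assumed for
  \<open>Z n - zs\<close> and \<open>T n\<close> are used in full.\<close>

lemma step_contra:
  assumes cs: "central_seq Z L S l"
    and slack: "\<And>i. i \<in> act \<Longrightarrow> (\<lambda>n. S n $ i / compl_gap (L n) (S n)) \<longlonglongrightarrow> \<sigma> $ i"
    and close: "\<And>n. norm (Z n - zs) \<le> K * compl_gap (L n) (S n)"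
    and t: "\<And>n. norm (T n) \<le> Kt * (compl_gap (L n) (S n))\<^sup>2"
    and \<theta>: "\<And>n. \<theta> n \<ge> 0" "(\<lambda>n. \<theta> n * compl_gap (L n) (S n)) \<longlonglongrightarrow> 0"
    and step: "\<And>n. scaled_step (\<theta> n) (Z n) (L n) (S n) (T n) (X n) (Y n) (W n)"
    and X: "X \<longlonglongrightarrow> x" and Y: "Y \<longlonglongrightarrow> y" and W: "W \<longlonglongrightarrow> w"
  shows "x = 0 \<and> y = 0 \<and> w = 0"
proof -
  note cent = centralityD[OF central_seqD(1)[OF cs]]
  note Z = central_seqD(2)[OF cs] and L = central_seqD(3)[OF cs] and l = central_seqD(4)[OF cs]
  define \<mu> where "\<mu> = (\<lambda>n. compl_gap (L n) (S n))"
  define H where "H = lagr_zz \<phi> g"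
  have \<mu>: "\<mu> n > 0" for n using cent(8) by (simp add: \<mu>_def)
  have \<mu>0: "\<mu> \<longlonglongrightarrow> 0" and \<theta>\<mu>: "(\<lambda>n. \<theta> n * \<mu> n) \<longlonglongrightarrow> 0"
    using central_seqD(5)[OF cs] \<theta>(2) by (simp_all add: \<mu>_def)
  \<comment> \<open>Centrality keeps \<open>L n $ i * (S n $ i / \<mu> n)\<close> above
    \<open>\<gamma>\<close>, and the second factor has a finite limit, so neither limit can be
    0.\<close>
  have lpos: "l $ i > 0" and \<sigma>pos: "\<sigma> $ i > 0" if i: "i \<in> act" for i
  proof -
    have "(\<lambda>n. L n $ i * (S n $ i / \<mu> n)) \<longlonglongrightarrow> l $ i * \<sigma> $ i"
      unfolding \<mu>_def by (intro tendsto_intros tendsto_vec_nth L slack[OF i])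
    moreover have "\<gamma> \<le> L n $ i * (S n $ i / \<mu> n)" for n
      using cent(5)[of n i] \<mu>[of n] by (simp add: \<mu>_def pos_le_divide_eq)
    ultimately have "\<gamma> \<le> l $ i * \<sigma> $ i"
      by (auto intro: LIMSEQ_le_const)
    then have "l $ i * \<sigma> $ i > 0" using \<gamma>_pos by linarith
    then show "l $ i > 0" "\<sigma> $ i > 0"
      using multsD(2)[OF l, of i] by (auto simp: zero_less_mult_iff)
  qed
  \<comment> \<open>\<open>\<theta> n\<close> may be unbounded; only
    \<open>\<theta> n * \<mu> n\<close> is known to vanish, which suffices for terms of order
    \<open>\<mu>\<close>.\<close>
  have scaled: "(\<lambda>n. \<theta> n *\<^sub>R v n) \<longlonglongrightarrow> 0"
    if "\<And>n. norm (v n) \<le> c * \<mu> n" for v :: "nat \<Rightarrow> 'b :: real_normed_vector" and c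
  proof (rule Lim_null_comparison[OF always_eventually[OF allI]])
    show "norm (\<theta> n *\<^sub>R v n) \<le> c * (\<theta> n * \<mu> n)" for n
      using mult_left_mono[OF that[of n] \<theta>(1)[of n]] \<theta>(1)[of n] by (simp add: mult.left_commute)
    show "(\<lambda>n. c * (\<theta> n * \<mu> n)) \<longlonglongrightarrow> 0"
      using tendsto_mult_right_zero[OF \<theta>\<mu>] .
  qed
  have tb: "\<bar>T n $ i\<bar> \<le> Kt * (\<mu> n)\<^sup>2" for n i
    using component_le_norm_cart[of "T n" i] t[of n] by (simp add: \<mu>_def)
  \<comment> \<open>The quadratic bound on \<open>T n\<close> leaves a term of order
    \<open>\<mu>\<close> after division by \<open>\<mu> n\<close>.\<close>
  have t\<mu>: "(\<lambda>n. \<theta> n * (T n $ i / \<mu> n)) \<longlonglongrightarrow> 0" for i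
  proof -
    have "norm (T n $ i / \<mu> n) \<le> Kt * \<mu> n" for n
      using tb[of n i] \<mu>[of n] by (simp add: pos_divide_le_eq power2_eq_square mult.assoc)
    from scaled[OF this] show ?thesis by simp
  qed
  have row1: "H zs l *v x + grads g zs *v y = 0"
  proof -
    have "(\<lambda>n. \<theta> n *\<^sub>R lagr_z \<phi> g (Z n) (L n)) \<longlonglongrightarrow> 0"
      by (rule scaled, unfold \<mu>_def, rule cent(1))
    from tendsto_minus[OF this] have "(\<lambda>n. H (Z n) (L n) *v X n + grads g (Z n) *v Y n) \<longlonglongrightarrow> 0"
      using step by (simp add: scaled_step_def H_def)
    moreover have "(\<lambda>n. H (Z n) (L n) *v X n + grads g (Z n) *v Y n) \<longlonglongrightarrow> H zs l *v x + grads g zs *v y"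
      unfolding H_def by (intro tendsto_intros tendsto_lagr_zz[OF Z L] tendsto_grads[OF Z] X Y)
    ultimately show ?thesis using LIMSEQ_unique by blast
  qed
  have row2: "dg i zs \<bullet> x + w $ i = 0" for i
  proof -
    have "(\<lambda>n. \<theta> n *\<^sub>R (g (Z n) + S n)) \<longlonglongrightarrow> 0"
      by (rule scaled, unfold \<mu>_def, rule cent(2))
    from tendsto_minus[OF tendsto_vec_nth[OF this, of i]] have "(\<lambda>n. dg i (Z n) \<bullet> X n + W n $ i) \<longlonglongrightarrow> 0"
      using step by (simp add: scaled_step_def)
    moreover have "(\<lambda>n. dg i (Z n) \<bullet> X n + W n $ i) \<longlonglongrightarrow> dg i zs \<bullet> x + w $ i"
      by (intro tendsto_intros tendsto_dg[OF Z] X tendsto_vec_nth[OF W])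
    ultimately show ?thesis using LIMSEQ_unique by blast
  qed
  have row3: "- g zs $ i * y $ i + l $ i * w $ i = 0" for i
  proof -
    have 1: "(\<lambda>n. \<theta> n *\<^sub>R (S n $ i * L n $ i)) \<longlonglongrightarrow> 0"
    proof (rule scaled)
      show "norm (S n $ i * L n $ i) \<le> real CARD('m) * \<mu> n" for n
        using cent(3,4,6)[of n i] cent(7)[of n] by (simp add: \<mu>_def mult.commute)
    qed
    have "(\<lambda>n. \<theta> n * (T n $ i / \<mu> n) * \<mu> n) \<longlonglongrightarrow> 0 * 0"
      by (intro tendsto_mult t\<mu> \<mu>0)
    moreover have "\<theta> n * (T n $ i / \<mu> n) * \<mu> n = \<theta> n * T n $ i" for n
      using \<mu>[of n] by simp
    ultimately have 2: "(\<lambda>n. \<theta> n * T n $ i) \<longlonglongrightarrow> 0" by simp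
    have "S n $ i * Y n $ i + L n $ i * W n $ i = - (\<theta> n *\<^sub>R (S n $ i * L n $ i) + \<theta> n * T n $ i)" for n
      using step[of n] by (simp add: scaled_step_def algebra_simps)
    with tendsto_minus[OF tendsto_add[OF 1 2]]
    have "(\<lambda>n. S n $ i * Y n $ i + L n $ i * W n $ i) \<longlonglongrightarrow> 0" by simp
    moreover have "(\<lambda>n. S n $ i * Y n $ i + L n $ i * W n $ i) \<longlonglongrightarrow> - g zs $ i * y $ i + l $ i * w $ i"
      by (intro tendsto_intros tendsto_slack[OF cs] tendsto_vec_nth L Y W)
    ultimately show ?thesis using LIMSEQ_unique by blast
  qed
  \<comment> \<open>In the limiting third row one coefficient vanishes for each index:
    \<open>l $ i\<close> if inactive, \<open>g zs $ i\<close> if active. The other is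
    nonzero.\<close>
  have inactive: "y $ i = 0" if "i \<notin> act" for i
    using row3[of i] KKT_complementary[OF l that] that by (simp add: active_def)
  have active: "w $ i = 0" if "i \<in> act" for i
    using row3[of i] lpos[OF that] that by (simp add: active_def)
  have crit: "dg i zs \<bullet> x = 0" if "i \<in> act" for i
    using row2[of i] active[OF that] by simp
  have x: "x = 0"
    using second_order_kernel[OF l crit inactive] row1 by (simp add: H_def)
  have w: "w = 0"
    using row2 x by (simp add: vec_eq_iff)
  have ker: "(\<Sum>i\<in>UNIV. y $ i * (dg i zs \<bullet> v)) = 0" for v
    using row1 x by (simp add: inner_grads_mult[symmetric])
  have ker: "(\<Sum>i\<in>act. y $ i * (dg i zs \<bullet> v)) = 0" for v
    using sum.mono_neutral_left[of UNIV act "\<lambda>i. y $ i * (dg i zs \<bullet> v)"] inactive ker[of v] by simp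
  text \<open>The limit says nothing more about \<open>y\<close>, which lies in the dual kernel. One has to go to
    the next order: test the complementarity rows, divided by \<open>\<mu>\<close>, with \<open>y\<close> itself.\<close>
  define a where "a = (\<lambda>i n. y $ i * (((dg i (Z n) - dg i zs) \<bullet> X n) / \<mu> n))"
  define b where "b = (\<lambda>i n. y $ i * (\<theta> n * ((g (Z n) $ i - g zs $ i - dg i zs \<bullet> (Z n - zs)) / \<mu> n)))"
  define c where "c = (\<lambda>i n. y $ i * (\<theta> n * (T n $ i / \<mu> n) / L n $ i))"
  \<comment> \<open>\<open>a\<close> vanishes since the gradient difference is of order
    \<open>\<mu>\<close> and \<open>X n\<close> tends to 0; \<open>b\<close> since the constraint
    remainder is of order \<open>\<mu>\<^sup>2\<close>; \<open>c\<close> by \<open>t\<mu>\<close>,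
    as \<open>L n $ i\<close> has a positive limit.\<close>
  have lim: "(\<lambda>n. a i n + b i n - c i n) \<longlonglongrightarrow> 0" if i: "i \<in> act" for i
  proof -
    obtain \<delta> M where \<delta>: "\<delta> > 0" "M > 0"
      and M: "\<And>z. norm (z - zs) < \<delta> \<Longrightarrow> norm (dg i z - dg i zs) \<le> M * norm (z - zs)"
        "\<And>z. norm (z - zs) < \<delta> \<Longrightarrow> \<bar>g z $ i - g zs $ i - dg i zs \<bullet> (z - zs)\<bar> \<le> M * (norm (z - zs))\<^sup>2"
      using locally_lipschitz_at_grad[OF smooth_constraint[of i], of zs] by blast
    have ev: "\<forall>\<^sub>F n in sequentially. norm (Z n - zs) < \<delta>"
      using tendstoD[OF Z \<open>\<delta> > 0\<close>] by (simp add: dist_norm)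
    have close: "norm (Z n - zs) \<le> K * \<mu> n" for n using close by (simp add: \<mu>_def)
    have "(\<lambda>n. ((dg i (Z n) - dg i zs) \<bullet> X n) / \<mu> n) \<longlonglongrightarrow> 0"
    proof (rule Lim_null_comparison)
      show "\<forall>\<^sub>F n in sequentially. norm (((dg i (Z n) - dg i zs) \<bullet> X n) / \<mu> n) \<le> M * K * norm (X n)"
        using ev
      proof eventually_elim
        case (elim n)
        have "norm (dg i (Z n) - dg i zs) \<le> M * (K * \<mu> n)"
          using M(1)[OF elim] mult_left_mono[OF close[of n], of M] \<delta>(2) by linarith
        then have "\<bar>(dg i (Z n) - dg i zs) \<bullet> X n\<bar> \<le> M * (K * \<mu> n) * norm (X n)"
          using Cauchy_Schwarz_ineq2[of "dg i (Z n) - dg i zs" "X n"]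
          by (meson mult_right_mono norm_ge_zero order_trans)
        then show ?case
          using \<mu>[of n] by (simp add: pos_divide_le_eq mult.assoc mult.left_commute mult.commute)
      qed
      show "(\<lambda>n. M * K * norm (X n)) \<longlonglongrightarrow> 0"
        using X unfolding x by (intro tendsto_mult_right_zero tendsto_norm_zero)
    qed
    then have "a i \<longlonglongrightarrow> 0" unfolding a_def by (rule tendsto_mult_right_zero)
    moreover have "(\<lambda>n. \<theta> n * ((g (Z n) $ i - g zs $ i - dg i zs \<bullet> (Z n - zs)) / \<mu> n)) \<longlonglongrightarrow> 0"
    proof (rule Lim_null_comparison)
      show "\<forall>\<^sub>F n in sequentially. norm (\<theta> n * ((g (Z n) $ i - g zs $ i - dg i zs \<bullet> (Z n - zs)) / \<mu> n))
        \<le> M * K\<^sup>2 * (\<theta> n * \<mu> n)"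
        using ev
      proof eventually_elim
        case (elim n)
        have "(norm (Z n - zs))\<^sup>2 \<le> (K * \<mu> n)\<^sup>2"
          by (intro power_mono close norm_ge_zero)
        then have "\<bar>g (Z n) $ i - g zs $ i - dg i zs \<bullet> (Z n - zs)\<bar> \<le> M * (K * \<mu> n)\<^sup>2"
          using M(2)[OF elim] mult_left_mono[of _ _ M] \<delta>(2) by (meson less_imp_le order_trans)
        then have "\<bar>g (Z n) $ i - g zs $ i - dg i zs \<bullet> (Z n - zs)\<bar> / \<mu> n \<le> M * K\<^sup>2 * \<mu> n"
          using \<mu>[of n] by (simp add: pos_divide_le_eq power2_eq_square mult.assoc mult.left_commute)
        from mult_left_mono[OF this \<theta>(1)[of n]] show ?case
          using \<mu>[of n] \<theta>(1)[of n] by (simp add: abs_mult mult.assoc mult.left_commute)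
      qed
      show "(\<lambda>n. M * K\<^sup>2 * (\<theta> n * \<mu> n)) \<longlonglongrightarrow> 0"
        using tendsto_mult_right_zero[OF \<theta>\<mu>] .
    qed
    then have "b i \<longlonglongrightarrow> 0" unfolding b_def by (rule tendsto_mult_right_zero)
    moreover have "c i \<longlonglongrightarrow> y $ i * (0 / l $ i)"
      unfolding c_def using lpos[OF i] by (intro tendsto_intros t\<mu> tendsto_vec_nth[OF L]) simp
    ultimately have "(\<lambda>n. a i n + b i n - c i n) \<longlonglongrightarrow> 0 + 0 - y $ i * (0 / l $ i)"
      by (intro tendsto_diff tendsto_add)
    then show ?thesis by simp
  qed
  \<comment> \<open>Eliminating \<open>W n\<close> between the second and third rows cancels the
    slacks in the residuals. Besides \<open>a\<close>, \<open>b\<close>, \<open>c\<close> there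
    remain \<open>y $ i * (dg i zs \<bullet> v)\<close> with
    \<open>v = X n /\<^sub>R \<mu> n\<close> and
    \<open>v = (\<theta> n / \<mu> n) *\<^sub>R (Z n - zs)\<close>. These need not be small, but
    they sum to 0 by \<open>ker\<close>.\<close>
  have "(\<Sum>i\<in>act. y $ i * (S n $ i / \<mu> n / L n $ i * Y n $ i)) = (\<Sum>i\<in>act. a i n + b i n - c i n)" for n
  proof -
    have "y $ i * (S n $ i / \<mu> n / L n $ i * Y n $ i) = a i n + b i n - c i n
      + y $ i * (dg i zs \<bullet> (X n /\<^sub>R \<mu> n)) + y $ i * (dg i zs \<bullet> ((\<theta> n / \<mu> n) *\<^sub>R (Z n - zs)))"
      if i: "i \<in> act" for i
    proof -
      have "S n $ i * Y n $ i + L n $ i * W n $ i = - \<theta> n * (S n $ i * L n $ i + T n $ i)"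
        using step[of n] by (simp add: scaled_step_def)
      then have "S n $ i * Y n $ i = - L n $ i * W n $ i - \<theta> n * (S n $ i * L n $ i + T n $ i)"
        by linarith
      then have "S n $ i * Y n $ i / L n $ i = - W n $ i - \<theta> n * (S n $ i + T n $ i / L n $ i)"
        using cent(3)[of n i] by (simp add: field_simps)
      moreover have "dg i (Z n) \<bullet> X n + W n $ i = - \<theta> n * (g (Z n) $ i + S n $ i)"
        using step[of n] by (simp add: scaled_step_def)
      ultimately have "S n $ i * Y n $ i / L n $ i = dg i (Z n) \<bullet> X n + \<theta> n * g (Z n) $ i - \<theta> n * (T n $ i / L n $ i)"
        by (simp add: algebra_simps)
      then have "S n $ i * Y n $ i / L n $ i / \<mu> n = (dg i (Z n) - dg i zs) \<bullet> X n / \<mu> n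
        + \<theta> n * ((g (Z n) $ i - g zs $ i - dg i zs \<bullet> (Z n - zs)) / \<mu> n) - \<theta> n * (T n $ i / \<mu> n) / L n $ i
        + dg i zs \<bullet> (X n /\<^sub>R \<mu> n) + dg i zs \<bullet> ((\<theta> n / \<mu> n) *\<^sub>R (Z n - zs))"
        using i by (simp add: active_def add_divide_distrib diff_divide_distrib inner_diff_left
            right_diff_distrib distrib_left divide_inverse mult.commute mult.left_commute)
      from arg_cong[OF this, of "\<lambda>u. y $ i * u"] show ?thesis
        by (simp add: a_def b_def c_def distrib_left right_diff_distrib mult.commute)
    qed
    then show ?thesis
      by (simp add: sum.distrib ker del: inner_scaleR_right)
  qed
  with tendsto_sum[OF lim, of act "\<lambda>i. i"]
  have "(\<lambda>n. \<Sum>i\<in>act. y $ i * (S n $ i / \<mu> n / L n $ i * Y n $ i)) \<longlonglongrightarrow> 0"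
    by simp
  moreover have "(\<lambda>n. \<Sum>i\<in>act. y $ i * (S n $ i / \<mu> n / L n $ i * Y n $ i)) \<longlonglongrightarrow>
    (\<Sum>i\<in>act. y $ i * (\<sigma> $ i / l $ i * y $ i))"
    unfolding \<mu>_def by (intro tendsto_intros slack tendsto_vec_nth L Y) (auto dest: lpos)
  ultimately have "(\<Sum>i\<in>act. y $ i * (\<sigma> $ i / l $ i * y $ i)) = 0"
    using LIMSEQ_unique by blast
  moreover have "y $ i * (\<sigma> $ i / l $ i * y $ i) \<ge> 0" if "i \<in> act" for i
  proof -
    have "\<sigma> $ i / l $ i * (y $ i * y $ i) \<ge> 0"
      using lpos[OF that] \<sigma>pos[OF that] by simp
    then show ?thesis by (simp add: mult.left_commute)
  qed
  ultimately have "y $ i * (\<sigma> $ i / l $ i * y $ i) = 0" if "i \<in> act" for i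
    using that by (subst (asm) sum_nonneg_eq_0_iff) auto
  then have "y $ i = 0" if "i \<in> act" for i
    using that lpos[OF that] \<sigma>pos[OF that] by fastforce
  then have "y $ i = 0" for i
    using inactive by blast
  with x w show ?thesis by (simp add: vec_eq_iff)
qed

text \<open>\<open>near_bound\<close> is applied with the constant 1 on the left and
  \<open>\<theta> * \<mu>\<close> on the right: a failure produces unit solutions with
  \<open>\<theta> * \<mu>\<close> tending to 0, whose limit is 0 by \<open>step_contra\<close>
  although it has norm 1.\<close>

lemma unit_step_bound:
  "\<exists>\<epsilon>>0. \<exists>K>0. \<forall>z lam s t \<theta> x y w. centrality \<phi> g C \<gamma> z lam s \<and>
    sol_dist \<phi> g zs z lam \<le> \<epsilon> \<and> compl_gap lam s \<le> \<epsilon> \<and> norm t \<le> Kt * (compl_gap lam s)\<^sup>2 \<and> \<theta> \<ge> 0 \<and>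
    scaled_step \<theta> z lam s t x y w \<and> norm (x, y, w) = 1 \<longrightarrow> 1 \<le> K * (\<theta> * compl_gap lam s)"
proof -
  obtain \<epsilon>1 K1 where 1: "\<epsilon>1 > 0" "K1 > 0"
    and K1: "\<And>z lam s. centrality \<phi> g C \<gamma> z lam s \<Longrightarrow> sol_dist \<phi> g zs z lam \<le> \<epsilon>1 \<Longrightarrow>
      compl_gap lam s \<le> \<epsilon>1 \<Longrightarrow> (\<Sum>i\<in>act. s $ i) + (norm (z - zs))\<^sup>2 \<le> K1 * compl_gap lam s"
    using active_slack_bound by blast
  have slack: "s $ i \<le> K1 * compl_gap lam s"
    if "centrality \<phi> g C \<gamma> z lam s" "sol_dist \<phi> g zs z lam \<le> \<epsilon>1" "compl_gap lam s \<le> \<epsilon>1" "i \<in> act"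
    for z lam s i
  proof -
    have "s $ i \<le> (\<Sum>i\<in>act. s $ i)"
      using that centralityD(4)[OF that(1)] by (intro member_le_sum) (auto simp: less_imp_le)
    then show ?thesis
      using K1[OF that(1-3)] zero_le_power2[of "norm (z - zs)"] by linarith
  qed
  obtain \<epsilon>2 K2 where 2: "\<epsilon>2 > 0" "K2 > 0"
    and K2: "\<And>z lam s. centrality \<phi> g C \<gamma> z lam s \<Longrightarrow> \<forall>i\<in>act. s $ i \<le> K1 * compl_gap lam s \<Longrightarrow>
      sol_dist \<phi> g zs z lam \<le> \<epsilon>2 \<Longrightarrow> compl_gap lam s \<le> \<epsilon>2 \<Longrightarrow> norm (z - zs) \<le> K2 * compl_gap lam s"
    using primal_error_bound[of K1] by blast
  define z where "z = (\<lambda>(z :: real ^ 'n, lam :: real ^ 'm, s :: real ^ 'm, t :: real ^ 'm, \<theta> :: real,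
    d :: (real ^ 'n) \<times> (real ^ 'm) \<times> (real ^ 'm)). z)"
  define lam where "lam = (\<lambda>(z :: real ^ 'n, lam :: real ^ 'm, s :: real ^ 'm, t :: real ^ 'm, \<theta> :: real,
    d :: (real ^ 'n) \<times> (real ^ 'm) \<times> (real ^ 'm)). lam)"
  define s where "s = (\<lambda>(z :: real ^ 'n, lam :: real ^ 'm, s :: real ^ 'm, t :: real ^ 'm, \<theta> :: real,
    d :: (real ^ 'n) \<times> (real ^ 'm) \<times> (real ^ 'm)). s)"
  define t where "t = (\<lambda>(z :: real ^ 'n, lam :: real ^ 'm, s :: real ^ 'm, t :: real ^ 'm, \<theta> :: real,
    d :: (real ^ 'n) \<times> (real ^ 'm) \<times> (real ^ 'm)). t)"
  define \<theta> where "\<theta> = (\<lambda>(z :: real ^ 'n, lam :: real ^ 'm, s :: real ^ 'm, t :: real ^ 'm, \<theta> :: real,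
    d :: (real ^ 'n) \<times> (real ^ 'm) \<times> (real ^ 'm)). \<theta>)"
  define d where "d = (\<lambda>(z :: real ^ 'n, lam :: real ^ 'm, s :: real ^ 'm, t :: real ^ 'm, \<theta> :: real,
    d :: (real ^ 'n) \<times> (real ^ 'm) \<times> (real ^ 'm)). d)"
  define \<mu> where "\<mu> = (\<lambda>q. compl_gap (lam q) (s q))"
  \<comment> \<open>The active slack ratios join the convergent companion so that their limits
    exist; they are bounded by \<open>K1\<close>. The inactive ratios blow up and are replaced by
    0.\<close>
  define \<sigma> :: "_ \<Rightarrow> real ^ 'm" where "\<sigma> = (\<lambda>q. \<chi> i. if i \<in> act then s q $ i / \<mu> q else 0)"
  \<comment> \<open>The two earlier bounds are built into \<open>P\<close>; they are supplied again
    from centrality and closeness at the final instantiation.\<close>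
  define P where "P = (\<lambda>q. centrality \<phi> g C \<gamma> (z q) (lam q) (s q) \<and> (\<forall>i\<in>act. s q $ i \<le> K1 * \<mu> q) \<and>
    norm (z q - zs) \<le> K2 * \<mu> q \<and> norm (t q) \<le> Kt * (\<mu> q)\<^sup>2 \<and> \<theta> q \<ge> 0 \<and>
    scaled_step (\<theta> q) (z q) (lam q) (s q) (t q) (fst (d q)) (fst (snd (d q))) (snd (snd (d q))) \<and>
    norm (d q) = 1)"
  have "\<exists>\<epsilon>>0. \<exists>K>0. \<forall>q. P q \<and> centrality \<phi> g C \<gamma> (z q) (lam q) (s q) \<and>
    sol_dist \<phi> g zs (z q) (lam q) \<le> \<epsilon> \<and> compl_gap (lam q) (s q) \<le> \<epsilon> \<longrightarrow> 1 \<le> K * (\<theta> q * \<mu> q)"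
  proof (rule near_bound[where X = "\<lambda>q. (d q, \<sigma> q)" and M = "1 + (\<Sum>i\<in>(UNIV :: 'm set). K1)"])
    fix q assume P: "P q"
    then have cent: "centrality \<phi> g C \<gamma> (z q) (lam q) (s q)" by (simp add: P_def)
    have \<mu>: "\<mu> q > 0" using centralityD(8)[OF cent] by (simp add: \<mu>_def)
    then show "\<theta> q * \<mu> q \<ge> 0" using P by (simp add: P_def)
    have "\<bar>\<sigma> q $ i\<bar> \<le> K1" for i
      using P \<mu> 1(2) centralityD(4)[OF cent, of i]
      by (auto simp: \<sigma>_def P_def pos_divide_le_eq abs_of_pos)
    then have "norm (\<sigma> q) \<le> (\<Sum>i\<in>(UNIV :: 'm set). K1)"
      using norm_le_l1_cart[of "\<sigma> q"] by (meson order_trans sum_mono)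
    then show "norm (d q, \<sigma> q) \<le> 1 + (\<Sum>i\<in>(UNIV :: 'm set). K1)"
      using norm_Pair_le[of "d q" "\<sigma> q"] P unfolding P_def by linarith
  next
    fix Q l v
    assume P: "\<And>n. P (Q n)" and cs: "central_seq (\<lambda>n. z (Q n)) (\<lambda>n. lam (Q n)) (\<lambda>n. s (Q n)) l"
      and v: "(\<lambda>n. (d (Q n), \<sigma> (Q n))) \<longlonglongrightarrow> v" and \<theta>: "(\<lambda>n. \<theta> (Q n) * \<mu> (Q n) / 1) \<longlonglongrightarrow> 0"
    obtain x y w \<sigma>0 where xyw: "v = ((x, y, w), \<sigma>0)" by (metis prod.exhaust)
    have d: "(\<lambda>n. d (Q n)) \<longlonglongrightarrow> (x, y, w)" and \<sigma>: "(\<lambda>n. \<sigma> (Q n)) \<longlonglongrightarrow> \<sigma>0"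
      using tendsto_fst[OF v] tendsto_snd[OF v] by (simp_all add: xyw)
    have "x = 0 \<and> y = 0 \<and> w = 0"
    proof (rule step_contra[OF cs, where K = K2 and Kt = Kt])
      show "(\<lambda>n. s (Q n) $ i / compl_gap (lam (Q n)) (s (Q n))) \<longlonglongrightarrow> \<sigma>0 $ i" if "i \<in> act" for i
        using tendsto_vec_nth[OF \<sigma>, of i] that by (simp add: \<sigma>_def \<mu>_def)
      show "(\<lambda>n. fst (d (Q n))) \<longlonglongrightarrow> x" "(\<lambda>n. fst (snd (d (Q n)))) \<longlonglongrightarrow> y"
        "(\<lambda>n. snd (snd (d (Q n)))) \<longlonglongrightarrow> w"
        using tendsto_fst[OF d] tendsto_fst[OF tendsto_snd[OF d]] tendsto_snd[OF tendsto_snd[OF d]] by simp_all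
    qed (use P \<theta> 2 in \<open>auto simp: P_def \<mu>_def\<close>)
    moreover have "norm (x, y, w) = 1"
      using tendsto_norm[OF d] P by (simp add: P_def LIMSEQ_const_iff)
    ultimately show False by (simp flip: zero_prod_def)
  qed
  then obtain \<epsilon>3 K3 where 3: "\<epsilon>3 > 0" "K3 > 0"
    and K3: "\<And>q. P q \<Longrightarrow> centrality \<phi> g C \<gamma> (z q) (lam q) (s q) \<Longrightarrow>
      sol_dist \<phi> g zs (z q) (lam q) \<le> \<epsilon>3 \<Longrightarrow> compl_gap (lam q) (s q) \<le> \<epsilon>3 \<Longrightarrow> 1 \<le> K3 * (\<theta> q * \<mu> q)"
    by blast
  have "1 \<le> K3 * (\<theta>' * compl_gap lam' s')"
    if "centrality \<phi> g C \<gamma> z' lam' s'" "sol_dist \<phi> g zs z' lam' \<le> min \<epsilon>1 (min \<epsilon>2 \<epsilon>3)"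
      "compl_gap lam' s' \<le> min \<epsilon>1 (min \<epsilon>2 \<epsilon>3)" "norm t' \<le> Kt * (compl_gap lam' s')\<^sup>2" "\<theta>' \<ge> 0"
      "scaled_step \<theta>' z' lam' s' t' x y w" "norm (x, y, w) = 1" for z' lam' s' t' \<theta>' x y w
    using K3[of "(z', lam', s', t', \<theta>', (x, y, w))"] K2[of z' lam' s'] slack[of z' lam' s'] that
    by (simp add: P_def z_def lam_def s_def t_def \<theta>_def d_def \<mu>_def)
  with 1 2 3 show ?thesis
    by (intro exI[of _ "min \<epsilon>1 (min \<epsilon>2 \<epsilon>3)"] conjI exI[of _ K3]) auto
qed

section \<open>Unique solvability and the size of the step\<close>

text \<open>As a linear map of the product space into itself, the block matrix is bijective as soon
  as it is injective.\<close>

definition step_map where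
  "step_map z lam s = (\<lambda>(x, y, w). (lagr_zz \<phi> g z lam *v x + grads g z *v y,
    transpose (grads g z) *v x + w, diag s *v y + diag lam *v w))"

lemma linear_step_map: "linear (step_map z lam s)"
  by (intro linearI) (auto simp: step_map_def split: prod.splits
      simp: matrix_vector_right_distrib matrix_vector_mult_scaleR algebra_simps
      simp del: transpose_matrix_vector)

lemma step_equations_iff:
  "step_equations \<phi> g z lam s t d \<longleftrightarrow>
    step_map z lam s d = - (lagr_z \<phi> g z lam, g z + s, (diag s ** diag lam) *v 1 + t)"
  by (auto simp: step_equations_def step_map_def split: prod.splits)

lemma scaled_step_iff:
  "scaled_step \<theta> z lam s t x y w \<longleftrightarrow>
    step_map z lam s (x, y, w) = - \<theta> *\<^sub>R (lagr_z \<phi> g z lam, g z + s, (diag s ** diag lam) *v 1 + t)"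
  by (simp add: scaled_step_def step_map_def vec_eq_iff[where 'b = 'm] transpose_grads_mult_nth diag_mult_nth
      del: transpose_matrix_vector flip: matrix_vector_mul_assoc)

end

theorem corollary4p3:
  fixes \<phi> :: "real ^ 'n \<Rightarrow> real"
    and g :: "real ^ 'n \<Rightarrow> real ^ 'm"
    and zs :: "real ^ 'n"
    and C \<gamma> Kt :: real
  assumes "twice_lipschitz_diff \<phi>"
    and "\<And>i. twice_lipschitz_diff (\<lambda>z. g z $ i)"
    and "nlp_solution \<phi> g zs"
    and "\<exists>lam. KKT \<phi> g zs lam"
    and "MFCQ g zs"
    and "second_order_conditions \<phi> g zs"
    and "strict_complementarity \<phi> g zs"
    and "C > 0" and "0 < \<gamma>" and "\<gamma> < 1" and "Kt > 0"
  shows "\<exists>\<epsilon>>0. \<exists>K>0. \<forall>z lam s t.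
    centrality \<phi> g C \<gamma> z lam s \<and> sol_dist \<phi> g zs z lam \<le> \<epsilon> \<and> compl_gap lam s \<le> \<epsilon> \<and>
    norm t \<le> Kt * (compl_gap lam s)\<^sup>2 \<longrightarrow>
      (\<exists>!d. step_equations \<phi> g z lam s t d) \<and>
      (\<forall>dz dlam ds. step_equations \<phi> g z lam s t (dz, dlam, ds) \<longrightarrow>
        norm (dz, dlam, ds) \<le> K * compl_gap lam s)"
proof -
  interpret degenerate_nlp \<phi> g zs C \<gamma>
    using assms by unfold_locales auto
  obtain \<epsilon> K where "\<epsilon> > 0" "K > 0" and K: "\<And>z lam s t \<theta> x y w. centrality \<phi> g C \<gamma> z lam s \<Longrightarrow>
    sol_dist \<phi> g zs z lam \<le> \<epsilon> \<Longrightarrow> compl_gap lam s \<le> \<epsilon> \<Longrightarrow> norm t \<le> Kt * (compl_gap lam s)\<^sup>2 \<Longrightarrow>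
    \<theta> \<ge> 0 \<Longrightarrow> scaled_step \<theta> z lam s t x y w \<Longrightarrow> norm (x, y, w) = 1 \<Longrightarrow> 1 \<le> K * (\<theta> * compl_gap lam s)"
    using unit_step_bound[of Kt] by blast
  have "(\<exists>!d. step_equations \<phi> g z lam s t d) \<and>
      (\<forall>dz dlam ds. step_equations \<phi> g z lam s t (dz, dlam, ds) \<longrightarrow>
        norm (dz, dlam, ds) \<le> K * compl_gap lam s)"
    if near: "centrality \<phi> g C \<gamma> z lam s" "sol_dist \<phi> g zs z lam \<le> \<epsilon>" "compl_gap lam s \<le> \<epsilon>"
      "norm t \<le> Kt * (compl_gap lam s)\<^sup>2" for z lam s t
  proof -
    define rhs where "rhs = (lagr_z \<phi> g z lam, g z + s, (diag s ** diag lam) *v 1 + t)"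
    interpret linear "step_map z lam s" by (rule linear_step_map)
    \<comment> \<open>Normalizing \<open>d\<close> replaces \<open>\<theta>\<close> by
      \<open>\<theta> / norm d\<close>, so the lower bound for unit solutions becomes an upper bound
      on \<open>norm d\<close>.\<close>
    have bound: "norm d \<le> K * (\<theta> * compl_gap lam s)"
      if d: "step_map z lam s d = - \<theta> *\<^sub>R rhs" "\<theta> \<ge> 0" "d \<noteq> 0" for d \<theta>
    proof -
      obtain x y w where xyw: "d /\<^sub>R norm d = (x, y, w)" by (metis prod.exhaust)
      have "step_map z lam s (x, y, w) = - (\<theta> / norm d) *\<^sub>R rhs"
        unfolding xyw[symmetric] scaleR d(1) by (simp add: divide_inverse_commute)
      moreover have "norm (x, y, w) = 1"
        unfolding xyw[symmetric] using d(3) by simp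
      ultimately have "1 \<le> K * (\<theta> / norm d * compl_gap lam s)"
        using K[OF near, of "\<theta> / norm d" x y w] d(2) by (simp add: scaled_step_iff rhs_def)
      then have "1 \<le> K * (\<theta> * compl_gap lam s) / norm d" by simp
      then show ?thesis using d(3) by (simp add: pos_le_divide_eq)
    qed
    \<comment> \<open>For \<open>\<theta> = 0\<close> the bound forces every kernel element to have
      norm 0.\<close>
    have "inj (step_map z lam s)"
      unfolding inj_iff_eq_0
    proof (intro allI impI, rule ccontr)
      show False if "step_map z lam s d = 0" "d \<noteq> 0" for d
        using bound[of d 0] that by simp
    qed
    then have "bij (step_map z lam s)"
      using linear_inj_imp_surj[OF linear_step_map] by (simp add: bij_def)
    then have "\<exists>!d. step_map z lam s d = - rhs"
      unfolding bij_iff by blast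
    moreover have "norm d \<le> K * compl_gap lam s" if "step_map z lam s d = - rhs" for d
    \<comment> \<open>A zero step cannot be normalized; its bound is just positivity of the gap.
      Otherwise \<open>\<theta> = 1\<close>.\<close>
    proof (cases "d = 0")
      case True
      then show ?thesis using centralityD(8)[OF near(1)] \<open>K > 0\<close> by simp
    next
      case False
      then show ?thesis using bound[of d 1] that by simp
    qed
    ultimately show ?thesis
      by (simp add: step_equations_iff rhs_def)
  qed
  then show ?thesis
    by (intro exI[of _ \<epsilon>] conjI exI[of _ K] \<open>\<epsilon> > 0\<close> \<open>K > 0\<close> allI impI) (elim conjE, simp)+
qed

end
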